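(* Let $\tau\ge 0$ and $\sigma\geq 0$ be such that the two conditions $$\sigma<e^{-\mu\tau}\sqrt{2\mu-2e^{\mu\tau}}$$ and $$\sigma<-G(\mu\tau)\sqrt{\tau}+\sqrt{G(\mu\tau)^2\tau-2G(\mu\tau)\tau+2}$$ are simultaneously satisfied for some $\mu>1$ (in particular, the expressions under the square roots are nonnegative). Let $w_0\in\mathbb{R}$, $w_0\neq0$, and let $w=w(t)$ be the solution of the stochastic delay differential equation $$\mathrm{d}w(t)=-w(t-\tau)\,\mathrm{d}t+\sigma\, w(t-\tau)\,\mathrm{d}B_t\quad (t>0),\qquad w(s)=w_0\ \text{ for } s\in[-\tau,0].$$ Then $\mathbb{E}[w(t)^2]$ decays exponentially to zero as $t\to\infty$, i.e., there exist constants $C,c>0$ such that $\mathbb{E}[w(t)^2]\le C e^{-ct}$ for all $t\ge0$.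
   Context: The function $G$ is defined for $s\ge 0$ by $$G(s):=\left(\frac{e^{2s}-1}{2s}\right)^{1/2},$$ with $G(0):=1$ by continuity. $B_t$ is a standard one-dimensional Brownian motion (Wiener process), and the equation is understood in the It\^{o} sense. The solution is the unique global adapted process $w$ on $[-\tau,\infty)$ satisfying the equation and the initial condition, with $\mathbb{E}\left[\int_{-\tau}^T|w(t)|^2\,\mathrm{d}t\right]<\infty$ for all $T<\infty$. *)

theory Defs
  imports "HOL-Probability.Probability"
begin

definition G :: "real \<Rightarrow> real" where
  "G s = (if s = 0 then 1 else sqrt ((exp (2 * s) - 1) / (2 * s)))"

(* A standard one-dimensional Brownian motion on [0, \<infinity>) with respect to a filtration F.
   Time is indexed by all reals only so that F can also serve processes started at a negative
   time; a filtration on [0, \<infinity>) is covered by putting F t = F 0 for t < 0.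
   The values of B at negative times are irrelevant. *)
locale brownian_motion = prob_space M + filtration "space M" F
  for M :: "'a measure" and F :: "real \<Rightarrow> 'a measure" +
  fixes B :: "real \<Rightarrow> 'a \<Rightarrow> real"
  assumes subalgebra_F: "subalgebra M (F t)"
    and adapted: "0 \<le> t \<Longrightarrow> B t \<in> borel_measurable (F t)"
    and start_zero: "AE x in M. B 0 x = 0"
    and continuous_paths: "AE x in M. continuous_on {0..} (\<lambda>t. B t x)"
    and normal_increments: "0 \<le> s \<Longrightarrow> s < t \<Longrightarrow>
      distributed M lborel (\<lambda>x. B t x - B s x) (normal_density 0 (sqrt (t - s)))"
    and indep_increments: "0 \<le> s \<Longrightarrow> s < t \<Longrightarrow>
      indep_set (sets (F s)) (sets (vimage_algebra (space M) (\<lambda>x. B t x - B s x) borel))"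

(* Jointly measurable, adapted processes H on the time set S with E [\<integral>_S |H t|^2 dt] < \<infinity>. *)
definition square_integrable_process ::
  "'a measure \<Rightarrow> (real \<Rightarrow> 'a measure) \<Rightarrow> real set \<Rightarrow> (real \<Rightarrow> 'a \<Rightarrow> real) \<Rightarrow> bool" where
  "square_integrable_process M F S H \<longleftrightarrow>
     (\<lambda>(t, x). H t x) \<in> borel_measurable (restrict_space borel S \<Otimes>\<^sub>M M) \<and>
     (\<forall>t\<in>S. H t \<in> borel_measurable (F t)) \<and>
     (\<integral>\<^sup>+x. (\<integral>\<^sup>+t\<in>S. ennreal ((H t x)\<^sup>2) \<partial>lborel) \<partial>M) < \<infinity>"

(* An elementary integrand on [0, T]: partition points p 0, ..., p n and, on each
   (p i, p (Suc i)], a bounded F (p i)-measurable random variable e i. *)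
definition elementary_integrand ::
  "'a measure \<Rightarrow> (real \<Rightarrow> 'a measure) \<Rightarrow> real \<Rightarrow> nat \<Rightarrow> (nat \<Rightarrow> real) \<Rightarrow> (nat \<Rightarrow> 'a \<Rightarrow> real) \<Rightarrow> bool" where
  "elementary_integrand M F T n p e \<longleftrightarrow>
     p 0 = 0 \<and> p n = T \<and>
     (\<forall>i<n. p i \<le> p (Suc i) \<and> e i \<in> borel_measurable (F (p i)) \<and> bounded (e i ` space M))"

definition elementary_process ::
  "nat \<Rightarrow> (nat \<Rightarrow> real) \<Rightarrow> (nat \<Rightarrow> 'a \<Rightarrow> real) \<Rightarrow> real \<Rightarrow> 'a \<Rightarrow> real" where
  "elementary_process n p e t x = (\<Sum>i<n. e i x * indicator {p i<..p (Suc i)} t)"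

definition elementary_integral ::
  "(real \<Rightarrow> 'a \<Rightarrow> real) \<Rightarrow> nat \<Rightarrow> (nat \<Rightarrow> real) \<Rightarrow> (nat \<Rightarrow> 'a \<Rightarrow> real) \<Rightarrow> 'a \<Rightarrow> real" where
  "elementary_integral B n p e x = (\<Sum>i<n. e i x * (B (p (Suc i)) x - B (p i) x))"

(* X is (a version of) the Ito integral of H over [0, T] with respect to B: the L^2 limit of the
   integrals of elementary integrands converging to H in L^2([0, T] \<times> M).
   By the Ito isometry X is determined up to a null set. *)
definition has_ito_integral ::
  "'a measure \<Rightarrow> (real \<Rightarrow> 'a measure) \<Rightarrow> (real \<Rightarrow> 'a \<Rightarrow> real) \<Rightarrow> (real \<Rightarrow> 'a \<Rightarrow> real) \<Rightarrow> real
     \<Rightarrow> ('a \<Rightarrow> real) \<Rightarrow> bool" where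
  "has_ito_integral M F B H T X \<longleftrightarrow>
     square_integrable_process M F {0..T} H \<and> X \<in> borel_measurable M \<and>
     (\<exists>n p e.
        (\<forall>k. elementary_integrand M F T (n k) (p k) (e k)) \<and>
        (\<lambda>k. \<integral>\<^sup>+x. (\<integral>\<^sup>+t\<in>{0..T}. ennreal ((H t x - elementary_process (n k) (p k) (e k) t x)\<^sup>2)
               \<partial>lborel) \<partial>M) \<longlonglongrightarrow> 0 \<and>
        (\<lambda>k. \<integral>\<^sup>+x. ennreal ((X x - elementary_integral B (n k) (p k) (e k) x)\<^sup>2) \<partial>M) \<longlonglongrightarrow> 0)"

(* dw(t) = - w(t - \<tau>) dt + \<sigma> w(t - \<tau>) dB_t for t > 0 and w = w0 on [-\<tau>, 0], in integrated form.
   The equation is required almost surely for each t; path continuity of w is not demanded, so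
   that every version of the solution is covered. *)
definition sdde_solution ::
  "'a measure \<Rightarrow> (real \<Rightarrow> 'a measure) \<Rightarrow> (real \<Rightarrow> 'a \<Rightarrow> real) \<Rightarrow> real \<Rightarrow> real \<Rightarrow> real
     \<Rightarrow> (real \<Rightarrow> 'a \<Rightarrow> real) \<Rightarrow> bool" where
  "sdde_solution M F B \<tau> \<sigma> w0 w \<longleftrightarrow>
     (\<forall>T. square_integrable_process M F {-\<tau>..T} w) \<and>
     (AE x in M. \<forall>s\<in>{-\<tau>..0}. w s x = w0) \<and>
     (\<forall>t>0. \<exists>I. has_ito_integral M F B (\<lambda>s x. \<sigma> * w (s - \<tau>) x) t I \<and>
        (AE x in M. w t x = w 0 x + (LBINT s:{0..t}. - w (s - \<tau>) x) + I x))"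

end

theory Submission
  imports Defs
begin

text \<open>
  Since \<open>G \<ge> 1\<close> on \<open>[0, \<infinity>)\<close>, squaring the second condition leaves \<open>\<sigma>\<^sup>2 + 2 \<tau> < 2\<close>, and this
  inequality alone forces the decay. The process \<open>Z(t) = w(t) - \<integral> w(r) dr\<close>, integrated over
  \<open>[t - \<tau>, t]\<close>, satisfies the equation \<open>dZ(t) = - w(t) dt + \<sigma> w(t - \<tau>) dB(t)\<close> without delay in
  the drift, so the Ito isometry and the martingale property of the Ito integral yield
  \<open>E Z(t)\<^sup>2 = E Z(0)\<^sup>2 - 2 \<integral> E (w(r) Z(r)) dr + \<sigma>\<^sup>2 \<integral> E w(r - \<tau>)\<^sup>2 dr\<close>, integrated over \<open>[0, t]\<close>.
  Estimating \<open>2 w(r) w(q) \<le> w(r)\<^sup>2 + w(q)\<^sup>2\<close> in the drift term bounds the growth of \<open>E Z\<^sup>2\<close> from \<open>s\<close>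
  to \<open>t\<close> by \<open>- (2 - 2 \<tau> - \<sigma>\<^sup>2) \<integral> E w(r)\<^sup>2 dr\<close> over \<open>[s, t]\<close> plus a multiple of the integral of
  \<open>E w\<^sup>2\<close> over \<open>[s - \<tau>, s]\<close>. Hence the future integral of \<open>E w\<^sup>2\<close> is controlled by the
  present state, which halves over every time interval of some fixed length.
\<close>

section \<open>Square integrable functions\<close>

text \<open>The identity for \<open>E Z(t)\<^sup>2\<close> is reached without an Ito formula. Write
  \<open>Z(t) = z0 - W(t) + I(t)\<close>, with \<open>W\<close> the integral of \<open>w\<close>
  over \<open>[0, t]\<close> and \<open>I\<close> the Ito integral. Expanding the square leaves one
  difficult term, the mixed moment \<open>E (W I)\<close>, which is the time integral of
  \<open>E (w(r) I(t))\<close>. The martingale property turns \<open>I(t)\<close> into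
  \<open>I(r)\<close>, and the equation at time \<open>r\<close> gives
  \<open>I(r) = Z(r) - z0 + W(r)\<close>; since the integral of \<open>w W\<close> is half the
  square of \<open>W\<close>, all terms in \<open>W\<close> cancel. The weak notion of solution
  dictates this form: the Ito integral is an L2 limit, fixed up to null sets for each time
  separately, and continuity of paths is not assumed. Hence the Ito integral is never treated as a
  process in time, and the decay comes from integral inequalities instead of a differential one. The
  constant \<open>2 - 2 \<tau> - \<sigma>\<^sup>2\<close> collects 2 from the drift, one
  \<open>\<tau>\<close> from each of the two squares in the estimate of the delayed product, and
  \<open>\<sigma>\<^sup>2\<close> from the isometry.\<close>

definition square_integrable :: "'a measure \<Rightarrow> ('a \<Rightarrow> real) \<Rightarrow> bool" where
  "square_integrable M f \<longleftrightarrow> f \<in> borel_measurable M \<and> integrable M (\<lambda>x. (f x)\<^sup>2)"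

lemma square_integrable_measurable [measurable_dest]:
  "square_integrable M f \<Longrightarrow> f \<in> borel_measurable M"
  by (simp add: square_integrable_def)

lemma square_integrable_power2:
  "square_integrable M f \<Longrightarrow> integrable M (\<lambda>x. (f x)\<^sup>2)"
  by (simp add: square_integrable_def)

lemma square_integrable_iff_nn_integral:
  "square_integrable M f \<longleftrightarrow>
    f \<in> borel_measurable M \<and> (\<integral>\<^sup>+x. ennreal ((f x)\<^sup>2) \<partial>M) < \<infinity>"
  by (auto simp: square_integrable_def integrable_iff_bounded)

lemma square_integrable_nn_integral:
  assumes "square_integrable M f"
  shows "(\<integral>\<^sup>+x. ennreal ((f x)\<^sup>2) \<partial>M) = ennreal (\<integral>x. (f x)\<^sup>2 \<partial>M)"
  by (rule nn_integral_eq_integral) (use assms in \<open>auto simp: square_integrable_def\<close>)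

lemma square_integrable_mult:
  assumes "square_integrable M f" "square_integrable M g"
  shows "integrable M (\<lambda>x. f x * g x)"
proof (rule Bochner_Integration.integrable_bound)
  show "integrable M (\<lambda>x. (f x)\<^sup>2 + (g x)\<^sup>2)"
    using assms by (simp add: square_integrable_def)
  show "(\<lambda>x. f x * g x) \<in> borel_measurable M"
    using assms[THEN square_integrable_measurable] by measurable
  have "\<bar>a * b\<bar> \<le> a\<^sup>2 + b\<^sup>2" for a b :: real
    using sum_squares_bound[of "\<bar>a\<bar>" "\<bar>b\<bar>"] zero_le_power2[of a] zero_le_power2[of b]
    unfolding abs_mult power2_abs by linarith
  then show "AE x in M. norm (f x * g x) \<le> norm ((f x)\<^sup>2 + (g x)\<^sup>2)"
    by simp
qed

lemma square_integrable_bound: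
  assumes "square_integrable M g" "f \<in> borel_measurable M" "AE x in M. \<bar>f x\<bar> \<le> \<bar>g x\<bar>"
  shows "square_integrable M f"
  unfolding square_integrable_def
proof
  show "integrable M (\<lambda>x. (f x)\<^sup>2)"
    by (rule Bochner_Integration.integrable_bound[OF square_integrable_power2[OF assms(1)]])
       (use assms(2,3) in \<open>auto simp flip: abs_le_square_iff\<close>)
qed fact

lemma square_integrable_add:
  assumes "square_integrable M f" "square_integrable M g"
  shows "square_integrable M (\<lambda>x. f x + g x)"
  unfolding square_integrable_def
proof
  show "(\<lambda>x. f x + g x) \<in> borel_measurable M"
    using assms[THEN square_integrable_measurable] by measurable
  have "integrable M (\<lambda>x. (f x)\<^sup>2 + (g x)\<^sup>2 + 2 * (f x * g x))"
    using assms square_integrable_mult[OF assms]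
    by (simp add: square_integrable_def)
  then show "integrable M (\<lambda>x. (f x + g x)\<^sup>2)"
    by (simp add: power2_sum mult.assoc)
qed

lemma square_integrable_cmult:
  "square_integrable M f \<Longrightarrow> square_integrable M (\<lambda>x. c * f x)"
  by (auto simp: square_integrable_def power_mult_distrib)

lemma square_integrable_diff:
  assumes "square_integrable M f" "square_integrable M g"
  shows "square_integrable M (\<lambda>x. f x - g x)"
  using square_integrable_add[OF assms(1) square_integrable_cmult[OF assms(2), of "-1"]] by simp

lemma square_integrable_const:
  "finite_measure M \<Longrightarrow> square_integrable M (\<lambda>x. c)"
  by (auto simp: square_integrable_def finite_measure.integrable_const)

lemma square_integrable_cong_AE:
  assumes "square_integrable M g" "f \<in> borel_measurable M" "AE x in M. f x = g x"
  shows "square_integrable M f"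
  by (rule square_integrable_bound[OF assms(1,2)]) (use assms(3) in auto)

lemma (in finite_measure) square_integrable_imp_integrable:
  "square_integrable M f \<Longrightarrow> integrable M f"
  using square_integrable_mult[OF _ square_integrable_const[OF finite_measure_axioms], of f 1] by simp

lemma square_integrable_Cauchy_Schwarz:
  assumes "square_integrable M f" "square_integrable M g"
  shows "\<bar>\<integral>x. f x * g x \<partial>M\<bar> \<le> sqrt (\<integral>x. (f x)\<^sup>2 \<partial>M) * sqrt (\<integral>x. (g x)\<^sup>2 \<partial>M)"
proof -
  let ?A = "\<integral>x. (f x)\<^sup>2 \<partial>M" and ?B = "\<integral>x. (g x)\<^sup>2 \<partial>M" and ?C = "\<integral>x. \<bar>f x * g x\<bar> \<partial>M"
  note [measurable] = assms[THEN square_integrable_measurable]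
  have int: "integrable M (\<lambda>x. \<bar>f x * g x\<bar>)"
    using square_integrable_mult[OF assms] by (rule integrable_abs)
  have "(\<integral>\<^sup>+x. ennreal \<bar>f x\<bar> * ennreal \<bar>g x\<bar> \<partial>M)\<^sup>2
      \<le> (\<integral>\<^sup>+x. (ennreal \<bar>f x\<bar>)\<^sup>2 \<partial>M) * (\<integral>\<^sup>+x. (ennreal \<bar>g x\<bar>)\<^sup>2 \<partial>M)"
    by (rule Cauchy_Schwarz_nn_integral) simp_all
  also have "(\<integral>\<^sup>+x. ennreal \<bar>f x\<bar> * ennreal \<bar>g x\<bar> \<partial>M) = (\<integral>\<^sup>+x. ennreal \<bar>f x * g x\<bar> \<partial>M)"
    by (simp add: ennreal_mult' abs_mult)
  also have "\<dots> = ennreal ?C"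
    by (rule nn_integral_eq_integral) (use int in auto)
  also have "(\<integral>\<^sup>+x. (ennreal \<bar>f x\<bar>)\<^sup>2 \<partial>M) = ennreal ?A"
    using square_integrable_nn_integral[OF assms(1)] by (simp add: ennreal_power)
  also have "(\<integral>\<^sup>+x. (ennreal \<bar>g x\<bar>)\<^sup>2 \<partial>M) = ennreal ?B"
    using square_integrable_nn_integral[OF assms(2)] by (simp add: ennreal_power)
  finally have "ennreal (?C\<^sup>2) \<le> ennreal (?A * ?B)"
    by (simp add: ennreal_power ennreal_mult)
  then have "?C\<^sup>2 \<le> ?A * ?B"
    by (subst (asm) ennreal_le_iff) auto
  then have "?C \<le> sqrt (?A * ?B)"
    by (simp add: real_le_rsqrt)
  moreover have "\<bar>\<integral>x. f x * g x \<partial>M\<bar> \<le> ?C"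
    by (rule integral_abs_bound)
  ultimately show ?thesis
    unfolding real_sqrt_mult by (rule order_trans[rotated])
qed

text \<open>The inner product of L2 is jointly continuous: \<open>u v - f g\<close> splits into
  \<open>(u - f)(v - g) + f (v - g) + (u - f) g\<close>, and Cauchy-Schwarz sends each part to zero.
  Statements about step integrands pass to Ito integrals through this lemma, with
  \<open>u = v\<close> for norms.\<close>

lemma square_integrable_tendsto_mult:
  assumes f: "square_integrable M f" "\<And>k. square_integrable M (u k)"
    and g: "square_integrable M g" "\<And>k. square_integrable M (v k)"
    and u: "(\<lambda>k. \<integral>x. (u k x - f x)\<^sup>2 \<partial>M) \<longlonglongrightarrow> 0"
    and v: "(\<lambda>k. \<integral>x. (v k x - g x)\<^sup>2 \<partial>M) \<longlonglongrightarrow> 0"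
  shows "(\<lambda>k. \<integral>x. u k x * v k x \<partial>M) \<longlonglongrightarrow> (\<integral>x. f x * g x \<partial>M)"
proof -
  have dF: "square_integrable M (\<lambda>x. u k x - f x)" for k
    using f by (simp add: square_integrable_diff)
  have dG: "square_integrable M (\<lambda>x. v k x - g x)" for k
    using g by (simp add: square_integrable_diff)
  have 1: "(\<lambda>k. \<integral>x. (u k x - f x) * (v k x - g x) \<partial>M) \<longlonglongrightarrow> 0"
  proof (rule Lim_null_comparison)
    show "\<forall>\<^sub>F k in sequentially. norm (\<integral>x. (u k x - f x) * (v k x - g x) \<partial>M)
      \<le> sqrt (\<integral>x. (u k x - f x)\<^sup>2 \<partial>M) * sqrt (\<integral>x. (v k x - g x)\<^sup>2 \<partial>M)"
      using square_integrable_Cauchy_Schwarz[OF dF dG] by simp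
    show "(\<lambda>k. sqrt (\<integral>x. (u k x - f x)\<^sup>2 \<partial>M) * sqrt (\<integral>x. (v k x - g x)\<^sup>2 \<partial>M)) \<longlonglongrightarrow> 0"
      using tendsto_mult[OF tendsto_real_sqrt[OF u] tendsto_real_sqrt[OF v]] by simp
  qed
  have 2: "(\<lambda>k. \<integral>x. f x * (v k x - g x) \<partial>M) \<longlonglongrightarrow> 0"
  proof (rule Lim_null_comparison)
    show "\<forall>\<^sub>F k in sequentially. norm (\<integral>x. f x * (v k x - g x) \<partial>M)
      \<le> sqrt (\<integral>x. (f x)\<^sup>2 \<partial>M) * sqrt (\<integral>x. (v k x - g x)\<^sup>2 \<partial>M)"
      using square_integrable_Cauchy_Schwarz[OF f(1) dG] by simp
    show "(\<lambda>k. sqrt (\<integral>x. (f x)\<^sup>2 \<partial>M) * sqrt (\<integral>x. (v k x - g x)\<^sup>2 \<partial>M)) \<longlonglongrightarrow> 0"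
      using tendsto_mult_left[OF tendsto_real_sqrt[OF v]] by simp
  qed
  have 3: "(\<lambda>k. \<integral>x. (u k x - f x) * g x \<partial>M) \<longlonglongrightarrow> 0"
  proof (rule Lim_null_comparison)
    show "\<forall>\<^sub>F k in sequentially. norm (\<integral>x. (u k x - f x) * g x \<partial>M)
      \<le> sqrt (\<integral>x. (u k x - f x)\<^sup>2 \<partial>M) * sqrt (\<integral>x. (g x)\<^sup>2 \<partial>M)"
      using square_integrable_Cauchy_Schwarz[OF dF g(1)] by simp
    show "(\<lambda>k. sqrt (\<integral>x. (u k x - f x)\<^sup>2 \<partial>M) * sqrt (\<integral>x. (g x)\<^sup>2 \<partial>M)) \<longlonglongrightarrow> 0"
      using tendsto_mult_right[OF tendsto_real_sqrt[OF u]] by simp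
  qed
  have "(\<integral>x. u k x * v k x \<partial>M) = (\<integral>x. (u k x - f x) * (v k x - g x) \<partial>M)
      + (\<integral>x. f x * (v k x - g x) \<partial>M) + (\<integral>x. (u k x - f x) * g x \<partial>M) + (\<integral>x. f x * g x \<partial>M)" for k
  proof -
    have "(\<integral>x. u k x * v k x \<partial>M) = (\<integral>x. (u k x - f x) * (v k x - g x)
      + f x * (v k x - g x) + (u k x - f x) * g x + f x * g x \<partial>M)"
      by (simp add: algebra_simps)
    then show ?thesis
      by (simp add: square_integrable_mult dF dG f(1) g(1))
  qed
  then show ?thesis
    using tendsto_add[OF tendsto_add[OF tendsto_add[OF 1 2] 3] tendsto_const[of "\<integral>x. f x * g x \<partial>M"]]
    by simp
qed

section \<open>Step integrands\<close>

lemma integrable_bounded_mult: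
  fixes e f :: "'a \<Rightarrow> real"
  assumes "e \<in> borel_measurable M" "bounded (e ` space M)" "integrable M f"
  shows "integrable M (\<lambda>x. e x * f x)"
proof -
  obtain C where C: "\<And>x. x \<in> space M \<Longrightarrow> \<bar>e x\<bar> \<le> C"
    using assms(2) by (auto simp: bounded_iff)
  show ?thesis
  proof (rule Bochner_Integration.integrable_bound[OF integrable_mult_right[OF assms(3), of C]])
    show "(\<lambda>x. e x * f x) \<in> borel_measurable M"
      using assms(1) borel_measurable_integrable[OF assms(3)] by measurable
    show "AE x in M. norm (e x * f x) \<le> norm (C * f x)"
      by (rule AE_I2) (auto simp: abs_mult intro!: mult_right_mono dest: C)
  qed
qed


lemma bounded_mult_image:
  fixes e f :: "'a \<Rightarrow> real"
  assumes "bounded (e ` A)" "bounded (f ` A)"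
  shows "bounded ((\<lambda>x. e x * f x) ` A)"
proof -
  obtain C D where C: "\<And>x. x \<in> A \<Longrightarrow> \<bar>e x\<bar> \<le> C" and D: "\<And>x. x \<in> A \<Longrightarrow> \<bar>f x\<bar> \<le> D"
    using assms by (auto simp: bounded_iff)
  have "\<bar>e x * f x\<bar> \<le> C * D" if "x \<in> A" for x
    using C[OF that] D[OF that] by (auto simp: abs_mult intro!: mult_mono)
  then show ?thesis by (auto simp: bounded_iff)
qed


section \<open>Moments of products of Brownian increments\<close>

context brownian_motion
begin

lemma F_measurable_mono:
  assumes "s \<le> t" "f \<in> borel_measurable (F s)"
  shows "f \<in> borel_measurable (F t)"
  using measurable_from_subalg[of "F t" "F s" f borel] assms sets_F_mono[of s t] space_F
  by (auto simp: subalgebra_def)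

lemma F_measurable: "f \<in> borel_measurable (F s) \<Longrightarrow> f \<in> borel_measurable M"
  using measurable_from_subalg[OF subalgebra_F] .

lemma B_measurable: "0 \<le> t \<Longrightarrow> B t \<in> borel_measurable M"
  by (rule F_measurable[OF adapted])

lemma increment_moments:
  assumes "0 \<le> a" "a < b"
  shows "integrable M (\<lambda>x. B b x - B a x)" "expectation (\<lambda>x. B b x - B a x) = 0"
    and "integrable M (\<lambda>x. (B b x - B a x)\<^sup>2)" "expectation (\<lambda>x. (B b x - B a x)\<^sup>2) = b - a"
proof -
  note D = normal_increments[OF assms]
  have pos: "0 < sqrt (b - a)" using assms by simp
  show "integrable M (\<lambda>x. B b x - B a x)"
    using distributed_integrable[OF D, of "\<lambda>x. x"] integrable_normal_moment[OF pos, of 0 1] by simp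
  show e: "expectation (\<lambda>x. B b x - B a x) = 0"
    using normal_distributed_expectation[OF pos D] .
  show "integrable M (\<lambda>x. (B b x - B a x)\<^sup>2)"
    using distributed_integrable[OF D, of "\<lambda>x. x\<^sup>2"] integrable_normal_moment[OF pos, of 0 2] by simp
  show "expectation (\<lambda>x. (B b x - B a x)\<^sup>2) = b - a"
    using normal_distributed_variance[OF pos D] assms by (simp add: e)
qed

lemma indep_var_increment:
  assumes "0 \<le> a" "a < b" "\<eta> \<in> borel_measurable (F a)"
  shows "indep_var borel \<eta> borel (\<lambda>x. B b x - B a x)"
  unfolding indep_var_eq
proof (intro conjI)
  show "\<eta> \<in> borel_measurable M" by (rule F_measurable) fact
  show "(\<lambda>x. B b x - B a x) \<in> borel_measurable M"
    using B_measurable[of a] B_measurable[of b] assms by simp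
  have 1: "sigma_sets (space M) {\<eta> -` A \<inter> space M |A. A \<in> sets borel} \<subseteq> sets (F a)"
    using sets.sigma_sets_subset[of "{\<eta> -` A \<inter> space M |A. A \<in> sets borel}" "F a"]
      measurable_sets[OF assms(3)] by (auto simp: space_F)
  have 2: "sigma_sets (space M) {(\<lambda>x. B b x - B a x) -` A \<inter> space M |A. A \<in> sets borel}
     \<subseteq> sets (vimage_algebra (space M) (\<lambda>x. B b x - B a x) borel)"
    using sets.sigma_sets_subset[of "{(\<lambda>x. B b x - B a x) -` A \<inter> space M |A. A \<in> sets borel}"
        "vimage_algebra (space M) (\<lambda>x. B b x - B a x) borel"]
    by (auto intro: in_vimage_algebra)
  show "indep_set (sigma_sets (space M) {\<eta> -` A \<inter> space M |A. A \<in> sets borel})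
     (sigma_sets (space M) {(\<lambda>x. B b x - B a x) -` A \<inter> space M |A. A \<in> sets borel})"
    using indep_increments[OF assms(1,2)] unfolding indep_set_def
    by (rule indep_sets_mono_sets) (use 1 2 in \<open>auto split: bool.splits\<close>)
qed

lemma mult_increment:
  assumes "0 \<le> a" "a \<le> b" "\<eta> \<in> borel_measurable (F a)" "integrable M \<eta>"
  shows "integrable M (\<lambda>x. \<eta> x * (B b x - B a x))"
    and "expectation (\<lambda>x. \<eta> x * (B b x - B a x)) = 0"
    and "integrable M (\<lambda>x. \<eta> x * (B b x - B a x)\<^sup>2)"
    and "expectation (\<lambda>x. \<eta> x * (B b x - B a x)\<^sup>2) = (b - a) * expectation \<eta>"
proof -
  have "integrable M (\<lambda>x. \<eta> x * (B b x - B a x)) \<and>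
    expectation (\<lambda>x. \<eta> x * (B b x - B a x)) = 0 \<and>
    integrable M (\<lambda>x. \<eta> x * (B b x - B a x)\<^sup>2) \<and>
    expectation (\<lambda>x. \<eta> x * (B b x - B a x)\<^sup>2) = (b - a) * expectation \<eta>"
  if ab: "a < b"
proof -
  note m = increment_moments[OF assms(1) ab]
  have i1: "indep_var borel \<eta> borel (\<lambda>x. B b x - B a x)"
    using indep_var_increment assms ab by blast
  have i2: "indep_var borel \<eta> borel (\<lambda>x. (B b x - B a x)\<^sup>2)"
    using indep_var_compose[OF i1, of "\<lambda>x. x" borel "\<lambda>x. x\<^sup>2" borel] by (simp add: comp_def)
  show ?thesis
    using indep_var_integrable[OF i1 assms(4) m(1)] indep_var_lebesgue_integral[OF i1 assms(4) m(1)]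
      indep_var_integrable[OF i2 assms(4) m(3)] indep_var_lebesgue_integral[OF i2 assms(4) m(3)] m
    by simp
qed
  then show "integrable M (\<lambda>x. \<eta> x * (B b x - B a x))"
    and "expectation (\<lambda>x. \<eta> x * (B b x - B a x)) = 0"
    and "integrable M (\<lambda>x. \<eta> x * (B b x - B a x)\<^sup>2)"
    and "expectation (\<lambda>x. \<eta> x * (B b x - B a x)\<^sup>2) = (b - a) * expectation \<eta>"
    using assms(2) by (cases "a = b"; simp)+
qed

text \<open>Only the overlap of the two intervals contributes: after cutting at \<open>c\<close> and
  at the end of the overlap, every product of increments over disjoint pieces has a factor that lies
  after all the others are known, so its mean is zero. Overlaps must be allowed since the intervals
  may come from two unrelated partitions.\<close>

lemma increment_product_ordered:
  assumes "0 \<le> a" "a \<le> b" "a \<le> c" "c \<le> d"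
    and e: "e \<in> borel_measurable (F a)" "bounded (e ` space M)"
    and f: "f \<in> borel_measurable (F c)" "bounded (f ` space M)"
  shows "integrable M (\<lambda>x. (e x * (B b x - B a x)) * (f x * (B d x - B c x))) \<and>
    expectation (\<lambda>x. (e x * (B b x - B a x)) * (f x * (B d x - B c x)))
      = measure lborel ({a<..b} \<inter> {c<..d}) * expectation (\<lambda>x. e x * f x)"
proof -
  define g where "g x = e x * f x" for x
  have gF: "g \<in> borel_measurable (F c)"
    unfolding g_def using F_measurable_mono[OF assms(3) e(1)] f(1) by simp
  have gM: "g \<in> borel_measurable M" using F_measurable[OF gF] .
  have gb: "bounded (g ` space M)" unfolding g_def by (rule bounded_mult_image[OF e(2) f(2)])
  have gi: "integrable M g"
    using integrable_bounded_mult[OF gM gb, of "\<lambda>_. 1"] by simp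
  have BF: "B s \<in> borel_measurable (F t)" if "0 \<le> s" "s \<le> t" for s t
    using F_measurable_mono[OF that(2) adapted[OF that(1)]] .
  have incr: "integrable M (\<lambda>x. B t x - B s x)" if "0 \<le> s" "s \<le> t" for s t
    using that increment_moments(1)[of s t] by (cases "s = t") auto
  have g_incr: "integrable M (\<lambda>x. g x * (B t x - B s x))" if "0 \<le> s" "s \<le> t" for s t
    using integrable_bounded_mult[OF gM gb incr[OF that]] .
  show ?thesis
  proof (cases "b \<le> c")
    case True
    have "(\<lambda>x. g x * (B b x - B a x)) \<in> borel_measurable (F c)"
      using gF BF[of a c] BF[of b c] assms True by simp
    from mult_increment(1,2)[OF _ assms(4) this g_incr[OF assms(1,2)]] assms True
    show ?thesis by (simp add: g_def mult.assoc mult.left_commute mult.commute)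
  next
    case False
    \<comment> \<open>\<open>m\<close> is the right end of the overlap. It equals \<open>b\<close>
      or \<open>d\<close>, so one of the two increments beyond \<open>m\<close> vanishes and their
      product drops out of the expansion below.\<close>
    define m where "m = min b d"
    have m: "c \<le> m" "m \<le> b" "m \<le> d" "m = b \<or> m = d" using False assms by (auto simp: m_def)
    have c0: "0 \<le> c" using assms by simp
    have 1: "(\<lambda>x. g x * (B c x - B a x)) \<in> borel_measurable (F c)"
      using gF BF[of a c] BF[of c c] assms by simp
    have gFm: "g \<in> borel_measurable (F m)" using F_measurable_mono[OF m(1) gF] .
    have 2: "(\<lambda>x. g x * (B m x - B c x)) \<in> borel_measurable (F m)"
      using gFm BF[of c m] BF[of m m] m c0 by simp
    have m0: "0 \<le> m" using m c0 by simp
    note i1 = mult_increment(1,2)[OF c0 assms(4) 1 g_incr[OF assms(1,3)]]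
    note i2 = mult_increment(3,4)[OF c0 m(1) gF gi]
    note i3 = mult_increment(1,2)[OF m0 m(3) 2 g_incr[OF c0 m(1)]]
    note i4 = mult_increment(1,2)[OF m0 m(2) 2 g_incr[OF c0 m(1)]]
    have eq: "(e x * (B b x - B a x)) * (f x * (B d x - B c x)) =
      g x * (B c x - B a x) * (B d x - B c x) + g x * (B m x - B c x)\<^sup>2
      + g x * (B m x - B c x) * (B d x - B m x) + g x * (B m x - B c x) * (B b x - B m x)" for x
    proof -
      have "(B b x - B m x) * (B d x - B m x) = 0" using m(4) by auto
      then have "(B b x - B a x) * (B d x - B c x) = (B c x - B a x) * (B d x - B c x)
        + (B m x - B c x)\<^sup>2 + (B m x - B c x) * (B d x - B m x) + (B m x - B c x) * (B b x - B m x)"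
        by (auto simp: algebra_simps power2_eq_square)
      then show ?thesis
        by (simp only: g_def mult.assoc distrib_left[symmetric] mult.left_commute[of "B b x - B a x"])
    qed
    have "{a<..b} \<inter> {c<..d} = {c<..m}" using assms by (auto simp: m_def)
    then have "measure lborel ({a<..b} \<inter> {c<..d}) = m - c" using m by simp
    then show ?thesis
      unfolding eq using i1 i2 i3 i4 by (simp flip: g_def)
  qed
qed

lemma increment_product:
  assumes "0 \<le> a" "a \<le> b" "0 \<le> c" "c \<le> d"
    and e: "e \<in> borel_measurable (F a)" "bounded (e ` space M)"
    and f: "f \<in> borel_measurable (F c)" "bounded (f ` space M)"
  shows "integrable M (\<lambda>x. (e x * (B b x - B a x)) * (f x * (B d x - B c x)))"
    and "expectation (\<lambda>x. (e x * (B b x - B a x)) * (f x * (B d x - B c x)))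
      = measure lborel ({a<..b} \<inter> {c<..d}) * expectation (\<lambda>x. e x * f x)"
proof (atomize (full), cases "a \<le> c")
  case True
  then show "integrable M (\<lambda>x. (e x * (B b x - B a x)) * (f x * (B d x - B c x))) \<and>
    expectation (\<lambda>x. (e x * (B b x - B a x)) * (f x * (B d x - B c x)))
      = measure lborel ({a<..b} \<inter> {c<..d}) * expectation (\<lambda>x. e x * f x)"
    using increment_product_ordered[OF assms(1,2) _ assms(4) e f] by blast
next
  case False
  then show "integrable M (\<lambda>x. (e x * (B b x - B a x)) * (f x * (B d x - B c x))) \<and>
    expectation (\<lambda>x. (e x * (B b x - B a x)) * (f x * (B d x - B c x)))
      = measure lborel ({a<..b} \<inter> {c<..d}) * expectation (\<lambda>x. e x * f x)"
    using increment_product_ordered[OF assms(3,4) _ assms(2) f e]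
    by (simp add: mult.commute Int_commute)
qed

text \<open>An arbitrary finite index set with possibly overlapping intervals, instead of a
  partition: differences and truncations of step integrands then stay in the class without a common
  refinement.\<close>

definition step_family :: "'i set \<Rightarrow> ('i \<Rightarrow> real) \<Rightarrow> ('i \<Rightarrow> real) \<Rightarrow> ('i \<Rightarrow> 'a \<Rightarrow> real) \<Rightarrow> bool" where
  "step_family S a b e \<longleftrightarrow> finite S \<and> (\<forall>i\<in>S. 0 \<le> a i \<and> a i \<le> b i \<and>
     e i \<in> borel_measurable (F (a i)) \<and> bounded (e i ` space M))"

text \<open>Both squares expand into double sums over pairs of indices, and on each side the pair
  \<open>(i, j)\<close> carries the length of the overlap of the two intervals: on the left by
  \<open>increment_product\<close>, on the right by integrating a product of indicators.\<close>

lemma step_isometry: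
  assumes "step_family S a b e"
  shows "square_integrable M (\<lambda>x. \<Sum>i\<in>S. e i x * (B (b i) x - B (a i) x))"
    and "(\<integral>\<^sup>+x. ennreal ((\<Sum>i\<in>S. e i x * (B (b i) x - B (a i) x))\<^sup>2) \<partial>M)
      = (\<integral>\<^sup>+x. (\<integral>\<^sup>+t. ennreal ((\<Sum>i\<in>S. e i x * indicator {a i<..b i} t)\<^sup>2) \<partial>lborel) \<partial>M)"
proof -
  have S: "finite S" "\<And>i. i \<in> S \<Longrightarrow> 0 \<le> a i" "\<And>i. i \<in> S \<Longrightarrow> a i \<le> b i"
    "\<And>i. i \<in> S \<Longrightarrow> e i \<in> borel_measurable (F (a i))" "\<And>i. i \<in> S \<Longrightarrow> bounded (e i ` space M)"
    using assms by (auto simp: step_family_def)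
  let ?J = "\<lambda>x. \<Sum>i\<in>S. e i x * (B (b i) x - B (a i) x)"
  let ?m = "\<lambda>i j. measure lborel ({a i<..b i} \<inter> {a j<..b j})"
  have prod: "integrable M (\<lambda>x. (e i x * (B (b i) x - B (a i) x)) * (e j x * (B (b j) x - B (a j) x)))"
    "expectation (\<lambda>x. (e i x * (B (b i) x - B (a i) x)) * (e j x * (B (b j) x - B (a j) x)))
      = ?m i j * expectation (\<lambda>x. e i x * e j x)" if "i \<in> S" "j \<in> S" for i j
    using increment_product[of "a i" "b i" "a j" "b j" "e i" "e j"] that S by auto
  have eM: "e i \<in> borel_measurable M" if "i \<in> S" for i
    using F_measurable[OF S(4)[OF that]] .
  have eint: "integrable M (\<lambda>x. e i x * e j x)" if "i \<in> S" "j \<in> S" for i j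
    using integrable_bounded_mult[OF _ bounded_mult_image[OF S(5) S(5)], of i j "\<lambda>_. 1"] eM that by simp
  have Jm: "?J \<in> borel_measurable M"
  proof (rule borel_measurable_sum)
    fix i assume i: "i \<in> S"
    then have "0 \<le> b i" using S(2,3)[OF i] by linarith
    then show "(\<lambda>x. e i x * (B (b i) x - B (a i) x)) \<in> borel_measurable M"
      using eM[OF i] B_measurable[of "a i"] B_measurable[of "b i"] S(2)[OF i] by simp
  qed
  have J2: "(?J x)\<^sup>2 = (\<Sum>i\<in>S. \<Sum>j\<in>S. (e i x * (B (b i) x - B (a i) x)) * (e j x * (B (b j) x - B (a j) x)))" for x
    by (simp add: power2_eq_square sum_product)
  have Ji: "integrable M (\<lambda>x. (?J x)\<^sup>2)"
    unfolding J2 using prod(1) by (intro Bochner_Integration.integrable_sum) auto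
  show sq: "square_integrable M ?J" using Jm Ji by (simp add: square_integrable_def)
  have "expectation (\<lambda>x. (?J x)\<^sup>2) = (\<Sum>i\<in>S. \<Sum>j\<in>S. ?m i j * expectation (\<lambda>x. e i x * e j x))"
    unfolding J2 using prod by (simp add: Bochner_Integration.integral_sum)
  also have "\<dots> = expectation (\<lambda>x. \<Sum>i\<in>S. \<Sum>j\<in>S. ?m i j * (e i x * e j x))"
    using eint by (simp add: Bochner_Integration.integral_sum)
  finally have E: "expectation (\<lambda>x. (?J x)\<^sup>2) = expectation (\<lambda>x. \<Sum>i\<in>S. \<Sum>j\<in>S. ?m i j * (e i x * e j x))" .
  have inner: "(\<integral>\<^sup>+t. ennreal ((\<Sum>i\<in>S. e i x * indicator {a i<..b i} t)\<^sup>2) \<partial>lborel)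
      = ennreal (\<Sum>i\<in>S. \<Sum>j\<in>S. ?m i j * (e i x * e j x))"
    and pos: "0 \<le> (\<Sum>i\<in>S. \<Sum>j\<in>S. ?m i j * (e i x * e j x))" for x
  proof -
    have int: "integrable lborel (\<lambda>t. (e i x * e j x) * indicator ({a i<..b i} \<inter> {a j<..b j}) t)" for i j
      by (rule integrable_mult_right)
        (auto intro!: integrable_real_indicator emeasure_bounded_finite bounded_Int)
    have eq: "(\<Sum>i\<in>S. e i x * indicator {a i<..b i} t)\<^sup>2
      = (\<Sum>i\<in>S. \<Sum>j\<in>S. (e i x * e j x) * indicator ({a i<..b i} \<inter> {a j<..b j}) t)" for t :: real
      by (simp only: power2_eq_square sum_product indicator_inter_arith mult_ac)
    have val: "(\<integral>t. (\<Sum>i\<in>S. e i x * indicator {a i<..b i} t)\<^sup>2 \<partial>lborel)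
      = (\<Sum>i\<in>S. \<Sum>j\<in>S. ?m i j * (e i x * e j x))"
      unfolding eq using int by (simp add: Bochner_Integration.integral_sum mult.commute)
    have "integrable lborel (\<lambda>t. (\<Sum>i\<in>S. e i x * indicator {a i<..b i} t)\<^sup>2)"
      unfolding eq using int by (intro Bochner_Integration.integrable_sum)
    from nn_integral_eq_integral[OF this] val
    show "(\<integral>\<^sup>+t. ennreal ((\<Sum>i\<in>S. e i x * indicator {a i<..b i} t)\<^sup>2) \<partial>lborel)
      = ennreal (\<Sum>i\<in>S. \<Sum>j\<in>S. ?m i j * (e i x * e j x))" by simp
    show "0 \<le> (\<Sum>i\<in>S. \<Sum>j\<in>S. ?m i j * (e i x * e j x))"
      unfolding val[symmetric] by simp
  qed
  have "integrable M (\<lambda>x. \<Sum>i\<in>S. \<Sum>j\<in>S. ?m i j * (e i x * e j x))"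
    using eint by (intro Bochner_Integration.integrable_sum) auto
  then show "(\<integral>\<^sup>+x. ennreal ((?J x)\<^sup>2) \<partial>M)
      = (\<integral>\<^sup>+x. (\<integral>\<^sup>+t. ennreal ((\<Sum>i\<in>S. e i x * indicator {a i<..b i} t)\<^sup>2) \<partial>lborel) \<partial>M)"
    unfolding inner square_integrable_nn_integral[OF sq] E
    by (subst nn_integral_eq_integral) (use pos in auto)
qed

end

section \<open>The Ito integral\<close>

lemma tendsto_integral_power2:
  assumes "\<And>k. square_integrable M (u k)"
    and "(\<lambda>k. \<integral>\<^sup>+x. ennreal ((u k x)\<^sup>2) \<partial>M) \<longlonglongrightarrow> 0"
  shows "(\<lambda>k. \<integral>x. (u k x)\<^sup>2 \<partial>M) \<longlonglongrightarrow> 0"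
  using assms(2) unfolding square_integrable_nn_integral[OF assms(1)]
  by (subst (asm) ennreal_0[symmetric], subst (asm) tendsto_ennreal_iff) auto

text \<open>Processes are jointly measurable only on their own time set and in the order (time,
  sample). Extending by zero and swapping the coordinates moves them to
  \<open>M \<Otimes>\<^sub>M lborel\<close>, whose L2 space is where integrands are
  compared.\<close>

lemma borel_measurable_indicator_times_swap:
  fixes H :: "real \<Rightarrow> 'a \<Rightarrow> real"
  assumes "(\<lambda>(t, x). H t x) \<in> borel_measurable (restrict_space borel S \<Otimes>\<^sub>M M)"
    and [measurable]: "S \<in> sets borel"
  shows "(\<lambda>(x, t). indicator S t * H t x) \<in> borel_measurable (M \<Otimes>\<^sub>M lborel)"
proof -
  let ?R = "restrict_space (borel \<Otimes>\<^sub>M M) (S \<times> space M)"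
  have "(\<lambda>z. (fst z, snd z)) \<in> measurable ?R (restrict_space borel S \<Otimes>\<^sub>M M)"
  proof (rule measurable_Pair)
    show "fst \<in> measurable ?R (restrict_space borel S)"
      by (intro measurable_restrict_space2 measurable_restrict_space1)
         (auto simp: space_restrict_space)
    show "snd \<in> measurable ?R M"
      by (intro measurable_restrict_space1) auto
  qed
  from measurable_compose[OF this assms(1)]
  have "(\<lambda>(t, x). H t x) \<in> borel_measurable ?R" by (simp add: case_prod_beta)
  then have *: "(\<lambda>z. indicator (S \<times> space M) z *\<^sub>R (case z of (t, x) \<Rightarrow> H t x))
      \<in> borel_measurable (borel \<Otimes>\<^sub>M M)"
    by (subst (asm) borel_measurable_restrict_space_iff) auto
  have "(\<lambda>z. indicator (S \<times> space M) (snd z, fst z) *\<^sub>R H (snd z) (fst z))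
      \<in> borel_measurable (M \<Otimes>\<^sub>M borel)"
    using measurable_compose[OF measurable_pair_swap' *] by (simp add: case_prod_beta)
  moreover have "(\<lambda>z. indicator (S \<times> space M) (snd z, fst z) *\<^sub>R H (snd z) (fst z))
      \<in> borel_measurable (M \<Otimes>\<^sub>M borel) \<longleftrightarrow>
      (\<lambda>(x, t). indicator S t * H t x) \<in> borel_measurable (M \<Otimes>\<^sub>M borel)"
    by (rule measurable_cong) (auto simp: space_pair_measure indicator_def)
  moreover have "sets (M \<Otimes>\<^sub>M lborel) = sets (M \<Otimes>\<^sub>M borel)"
    by (intro sets_pair_measure_cong) auto
  ultimately show ?thesis
    by (simp add: measurable_cong_sets[OF \<open>sets (M \<Otimes>\<^sub>M lborel) = sets (M \<Otimes>\<^sub>M borel)\<close> refl])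
qed

lemma square_integrable_process_product:
  assumes H: "square_integrable_process M F S H" and [measurable]: "S \<in> sets borel"
  shows "square_integrable (M \<Otimes>\<^sub>M lborel) (\<lambda>(x, t). indicator S t * H t x)"
proof -
  let ?H = "\<lambda>(x, t). indicator S t * H t x"
  have Hm: "?H \<in> borel_measurable (M \<Otimes>\<^sub>M lborel)"
    using H by (intro borel_measurable_indicator_times_swap) (auto simp: square_integrable_process_def)
  have "(\<integral>\<^sup>+z. ennreal ((?H z)\<^sup>2) \<partial>(M \<Otimes>\<^sub>M lborel)) = (\<integral>\<^sup>+x. (\<integral>\<^sup>+t. ennreal ((?H (x, t))\<^sup>2) \<partial>lborel) \<partial>M)"
    using Hm by (intro lborel.nn_integral_fst[symmetric]) simp
  also have "\<dots> = (\<integral>\<^sup>+x. (\<integral>\<^sup>+t\<in>S. ennreal ((H t x)\<^sup>2) \<partial>lborel) \<partial>M)"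
    by (intro nn_integral_cong) (auto simp: indicator_def)
  also have "\<dots> < \<infinity>" using H by (simp add: square_integrable_process_def)
  finally show ?thesis
    using Hm by (simp add: square_integrable_iff_nn_integral)
qed

lemma square_integrable_process_subset:
  assumes H: "square_integrable_process M F S H" and "S' \<subseteq> S"
  shows "square_integrable_process M F S' H"
  unfolding square_integrable_process_def
proof (intro conjI)
  have "(\<lambda>z. (fst z, snd z)) \<in> measurable (restrict_space borel S' \<Otimes>\<^sub>M M) (restrict_space borel S \<Otimes>\<^sub>M M)"
  proof (rule measurable_Pair)
    have "fst \<in> measurable (restrict_space borel S' \<Otimes>\<^sub>M M) (borel :: real measure)"
      using measurable_fst by (rule measurable_compose) (rule measurable_restrict_space1, simp)
    then show "fst \<in> measurable (restrict_space borel S' \<Otimes>\<^sub>M M) (restrict_space borel S)"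
      by (intro measurable_restrict_space2)
        (use assms(2) in \<open>auto simp: space_pair_measure space_restrict_space\<close>)
  qed simp
  moreover have "(\<lambda>(t, x). H t x) \<in> borel_measurable (restrict_space borel S \<Otimes>\<^sub>M M)"
    using H by (simp add: square_integrable_process_def)
  ultimately have "(\<lambda>z. case (fst z, snd z) of (t, x) \<Rightarrow> H t x) \<in> borel_measurable (restrict_space borel S' \<Otimes>\<^sub>M M)"
    by (rule measurable_compose)
  then show "(\<lambda>(t, x). H t x) \<in> borel_measurable (restrict_space borel S' \<Otimes>\<^sub>M M)"
    by simp
  show "\<forall>t\<in>S'. H t \<in> borel_measurable (F t)"
    using H assms(2) by (auto simp: square_integrable_process_def)
  have "(\<integral>\<^sup>+x. (\<integral>\<^sup>+t\<in>S'. ennreal ((H t x)\<^sup>2) \<partial>lborel) \<partial>M) \<le> (\<integral>\<^sup>+x. (\<integral>\<^sup>+t\<in>S. ennreal ((H t x)\<^sup>2) \<partial>lborel) \<partial>M)"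
    using assms(2) by (intro nn_integral_mono) (auto simp: indicator_def)
  also have "\<dots> < \<infinity>" using H by (simp add: square_integrable_process_def)
  finally show "(\<integral>\<^sup>+x. (\<integral>\<^sup>+t\<in>S'. ennreal ((H t x)\<^sup>2) \<partial>lborel) \<partial>M) < \<infinity>" .
qed

section \<open>Ito integrals as L2 limits of step integrals: isometry and martingale
  property\<close>

context brownian_motion
begin

abbreviation Mt :: "('a \<times> real) measure" where "Mt \<equiv> M \<Otimes>\<^sub>M lborel"

definition step_process :: "'i set \<Rightarrow> ('i \<Rightarrow> real) \<Rightarrow> ('i \<Rightarrow> real) \<Rightarrow> ('i \<Rightarrow> 'a \<Rightarrow> real) \<Rightarrow> 'a \<times> real \<Rightarrow> real" where
  "step_process S a b e = (\<lambda>(x, t). \<Sum>i\<in>S. e i x * indicator {a i<..b i} t)"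

definition step_integral :: "'i set \<Rightarrow> ('i \<Rightarrow> real) \<Rightarrow> ('i \<Rightarrow> real) \<Rightarrow> ('i \<Rightarrow> 'a \<Rightarrow> real) \<Rightarrow> 'a \<Rightarrow> real" where
  "step_integral S a b e x = (\<Sum>i\<in>S. e i x * (B (b i) x - B (a i) x))"

lemma step_isometry_product:
  assumes S: "step_family S a b e"
  shows "square_integrable M (step_integral S a b e)"
    and "square_integrable Mt (step_process S a b e)"
    and "(\<integral>z. (step_process S a b e z)\<^sup>2 \<partial>Mt) = expectation (\<lambda>x. (step_integral S a b e x)\<^sup>2)"
proof -
  show J: "square_integrable M (step_integral S a b e)"
    using step_isometry(1)[OF S] unfolding step_integral_def .
  have eM: "e i \<in> borel_measurable M" if "i \<in> S" for i
    using S that F_measurable[of "e i" "a i"] by (auto simp: step_family_def)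
  have meas: "step_process S a b e \<in> borel_measurable Mt"
    unfolding step_process_def case_prod_beta
    by (intro borel_measurable_sum borel_measurable_times measurable_compose[OF measurable_fst eM]
        measurable_compose[OF measurable_snd borel_measurable_indicator]) auto
  have nn: "(\<integral>\<^sup>+z. ennreal ((step_process S a b e z)\<^sup>2) \<partial>Mt)
      = ennreal (expectation (\<lambda>x. (step_integral S a b e x)\<^sup>2))"
  proof -
    have "(\<integral>\<^sup>+z. ennreal ((step_process S a b e z)\<^sup>2) \<partial>Mt)
       = (\<integral>\<^sup>+x. (\<integral>\<^sup>+t. ennreal ((step_process S a b e (x, t))\<^sup>2) \<partial>lborel) \<partial>M)"
      using meas by (intro lborel.nn_integral_fst[symmetric]) simp
    also have "\<dots> = (\<integral>\<^sup>+x. ennreal ((step_integral S a b e x)\<^sup>2) \<partial>M)"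
      using step_isometry(2)[OF S] by (simp add: step_process_def step_integral_def)
    finally show ?thesis using square_integrable_nn_integral[OF J] by simp
  qed
  then show sq: "square_integrable Mt (step_process S a b e)"
    using meas by (simp add: square_integrable_iff_nn_integral)
  show "(\<integral>z. (step_process S a b e z)\<^sup>2 \<partial>Mt) = expectation (\<lambda>x. (step_integral S a b e x)\<^sup>2)"
    using nn unfolding square_integrable_nn_integral[OF sq] by simp
qed

lemma elementary_integrand_bounds:
  assumes "elementary_integrand M F T n p e" "i \<le> n"
  shows "0 \<le> p i" "p i \<le> T"
proof -
  have st: "p k \<le> p (Suc k)" if "k < n" for k
    using assms that by (auto simp: elementary_integrand_def)
  have 0: "p 0 = 0" "p n = T" using assms by (auto simp: elementary_integrand_def)
  have "i \<le> n \<Longrightarrow> p 0 \<le> p i" for i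
  proof (induction i)
    case (Suc i) then show ?case using st[of i] by simp
  qed simp
  then show "0 \<le> p i" using 0 assms(2) by simp
  have "p i \<le> p n" using assms(2)
  proof (induction i rule: inc_induct)
    case (step k) then show ?case using st[of k] by simp
  qed simp
  then show "p i \<le> T" using 0 by simp
qed

lemma elementary_integrand_step_family:
  assumes "elementary_integrand M F T n p e"
  shows "step_family {..<n} p (\<lambda>i. p (Suc i)) e"
  using assms elementary_integrand_bounds[OF assms]
  by (auto simp: elementary_integrand_def step_family_def)

lemma elementary_process_eq: "elementary_process n p e t x = step_process {..<n} p (\<lambda>i. p (Suc i)) e (x, t)"
  by (simp add: elementary_process_def step_process_def)

lemma elementary_integral_eq: "elementary_integral B n p e = step_integral {..<n} p (\<lambda>i. p (Suc i)) e"
  by (rule ext) (simp add: elementary_integral_def step_integral_def)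

text \<open>Allows the distance over \<open>{0..T}\<close> in \<open>has_ito_integral\<close> to be
  read as a distance over all times, once \<open>H\<close> is cut off outside
  \<open>{0..T}\<close>.\<close>

lemma elementary_process_outside:
  assumes "elementary_integrand M F T n p e" "t \<notin> {0..T}"
  shows "step_process {..<n} p (\<lambda>i. p (Suc i)) e (x, t) = 0"
  unfolding step_process_def prod.case
proof (rule sum.neutral, rule ballI)
  fix i assume "i \<in> {..<n}"
  then have "t \<notin> {p i<..p (Suc i)}"
    using elementary_integrand_bounds[OF assms(1), of i] elementary_integrand_bounds[OF assms(1), of "Suc i"] assms(2)
    by auto
  then show "e i x * indicator {p i<..p (Suc i)} t = 0" by simp
qed

lemma has_ito_integral_approx:
  assumes "has_ito_integral M F B H T X"
  obtains n p e where
    "\<And>k. elementary_integrand M F T (n k) (p k) (e k)"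
    "(\<lambda>k. \<integral>x. (step_integral {..<n k} (p k) (\<lambda>i. p k (Suc i)) (e k) x - X x)\<^sup>2 \<partial>M) \<longlonglongrightarrow> 0"
    "(\<lambda>k. \<integral>z. (step_process {..<n k} (p k) (\<lambda>i. p k (Suc i)) (e k) z
       - (case z of (x, t) \<Rightarrow> indicator {0..T} t * H t x))\<^sup>2 \<partial>Mt) \<longlonglongrightarrow> 0"
    "square_integrable M X"
    "square_integrable Mt (\<lambda>(x, t). indicator {0..T} t * H t x)"
proof -
  from assms obtain n p e where
    el: "\<And>k. elementary_integrand M F T (n k) (p k) (e k)"
    and lim1: "(\<lambda>k. \<integral>\<^sup>+x. (\<integral>\<^sup>+t\<in>{0..T}. ennreal ((H t x - elementary_process (n k) (p k) (e k) t x)\<^sup>2)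
               \<partial>lborel) \<partial>M) \<longlonglongrightarrow> 0"
    and lim2: "(\<lambda>k. \<integral>\<^sup>+x. ennreal ((X x - elementary_integral B (n k) (p k) (e k) x)\<^sup>2) \<partial>M) \<longlonglongrightarrow> 0"
    and sqp: "square_integrable_process M F {0..T} H"
    and [measurable]: "X \<in> borel_measurable M"
    unfolding has_ito_integral_def by blast
  let ?H = "\<lambda>(x, t). indicator {0..T} t * H t x"
  let ?J = "\<lambda>k. step_integral {..<n k} (p k) (\<lambda>i. p k (Suc i)) (e k)"
  let ?P = "\<lambda>k. step_process {..<n k} (p k) (\<lambda>i. p k (Suc i)) (e k)"
  note sf = elementary_integrand_step_family[OF el]
  note iso = step_isometry_product[OF sf]
  have Hs: "square_integrable Mt ?H"
    using square_integrable_process_product[OF sqp] by simp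
  \<comment> \<open>\<open>X\<close> is only assumed measurable. A step integral at finite L2
    distance from it makes it square integrable.\<close>
  obtain k0 where "(\<integral>\<^sup>+x. ennreal ((X x - ?J k0 x)\<^sup>2) \<partial>M) < 1"
    using order_tendstoD(2)[OF lim2, of 1] by (auto simp: elementary_integral_eq eventually_sequentially)
  then have "square_integrable M (\<lambda>x. X x - ?J k0 x)"
    using square_integrable_measurable[OF iso(1)[of k0]]
    by (auto simp: square_integrable_iff_nn_integral intro: less_trans)
  from square_integrable_add[OF this iso(1)[of k0]]
  have Xs: "square_integrable M X" by simp
  have 1: "(\<lambda>k. \<integral>x. (?J k x - X x)\<^sup>2 \<partial>M) \<longlonglongrightarrow> 0"
  proof (rule tendsto_integral_power2)
    show "square_integrable M (\<lambda>x. ?J k x - X x)" for k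
      using iso(1) Xs by (rule square_integrable_diff)
    show "(\<lambda>k. \<integral>\<^sup>+x. ennreal ((?J k x - X x)\<^sup>2) \<partial>M) \<longlonglongrightarrow> 0"
      using lim2 by (simp add: elementary_integral_eq power2_commute)
  qed
  have 2: "(\<lambda>k. \<integral>z. (?P k z - ?H z)\<^sup>2 \<partial>Mt) \<longlonglongrightarrow> 0"
  proof (rule tendsto_integral_power2)
    show sq: "square_integrable Mt (\<lambda>z. ?P k z - ?H z)" for k
      using iso(2) Hs by (rule square_integrable_diff)
    have "(\<integral>\<^sup>+z. ennreal ((?P k z - ?H z)\<^sup>2) \<partial>Mt)
      = (\<integral>\<^sup>+x. (\<integral>\<^sup>+t\<in>{0..T}. ennreal ((H t x - elementary_process (n k) (p k) (e k) t x)\<^sup>2)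
               \<partial>lborel) \<partial>M)" for k
    proof -
      have "(\<integral>\<^sup>+z. ennreal ((?P k z - ?H z)\<^sup>2) \<partial>Mt)
        = (\<integral>\<^sup>+x. (\<integral>\<^sup>+t. ennreal ((?P k (x, t) - ?H (x, t))\<^sup>2) \<partial>lborel) \<partial>M)"
        using square_integrable_measurable[OF sq[of k]] by (intro lborel.nn_integral_fst[symmetric]) simp
      also have "\<dots> = (\<integral>\<^sup>+x. (\<integral>\<^sup>+t\<in>{0..T}. ennreal ((H t x - elementary_process (n k) (p k) (e k) t x)\<^sup>2)
               \<partial>lborel) \<partial>M)"
        using elementary_process_outside[OF el]
        by (intro nn_integral_cong) (auto simp: indicator_def elementary_process_eq power2_commute)
      finally show ?thesis .
    qed
    then show "(\<lambda>k. \<integral>\<^sup>+z. ennreal ((?P k z - ?H z)\<^sup>2) \<partial>Mt) \<longlonglongrightarrow> 0"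
      using lim1 by simp
  qed
  show thesis by (rule that[OF el 1 2 Xs Hs])
qed

lemma ito_isometry:
  assumes "has_ito_integral M F B H T X"
  shows "expectation (\<lambda>x. (X x)\<^sup>2) = (\<integral>z. (case z of (x, t) \<Rightarrow> indicator {0..T} t * H t x)\<^sup>2 \<partial>Mt)"
proof -
  obtain n p e where el: "\<And>k. elementary_integrand M F T (n k) (p k) (e k)"
    and l1: "(\<lambda>k. \<integral>x. (step_integral {..<n k} (p k) (\<lambda>i. p k (Suc i)) (e k) x - X x)\<^sup>2 \<partial>M) \<longlonglongrightarrow> 0"
    and l2: "(\<lambda>k. \<integral>z. (step_process {..<n k} (p k) (\<lambda>i. p k (Suc i)) (e k) z
       - (case z of (x, t) \<Rightarrow> indicator {0..T} t * H t x))\<^sup>2 \<partial>Mt) \<longlonglongrightarrow> 0"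
    and sX: "square_integrable M X"
    and sH: "square_integrable Mt (\<lambda>(x, t). indicator {0..T} t * H t x)"
    using has_ito_integral_approx[OF assms] by blast
  note iso = step_isometry_product[OF elementary_integrand_step_family[OF el]]
  have "(\<lambda>k. \<integral>x. (step_integral {..<n k} (p k) (\<lambda>i. p k (Suc i)) (e k) x)\<^sup>2 \<partial>M) \<longlonglongrightarrow> (\<integral>x. (X x)\<^sup>2 \<partial>M)"
    using square_integrable_tendsto_mult[OF sX iso(1) sX iso(1) l1 l1] by (simp add: power2_eq_square)
  moreover have "(\<lambda>k. \<integral>z. (step_process {..<n k} (p k) (\<lambda>i. p k (Suc i)) (e k) z)\<^sup>2 \<partial>Mt)
      \<longlonglongrightarrow> (\<integral>z. (case z of (x, t) \<Rightarrow> indicator {0..T} t * H t x)\<^sup>2 \<partial>Mt)"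
    using square_integrable_tendsto_mult[OF sH iso(2) sH iso(2) l2 l2] by (simp add: power2_eq_square)
  ultimately show ?thesis
    unfolding iso(3) by (rule LIMSEQ_unique)
qed

text \<open>The two index sets are joined as a disjoint sum, and the resulting intervals may
  overlap. In this way the isometry measures the distance between step integrals built on different
  partitions.\<close>

lemma step_family_difference:
  assumes "step_family S a b e" "step_family S' a' b' e'"
  shows "\<exists>(T :: ('i + 'j) set) c d f. step_family T c d f \<and>
    step_process T c d f = (\<lambda>z. step_process (S::'i set) a b e z - step_process (S'::'j set) a' b' e' z) \<and>
    step_integral T c d f = (\<lambda>x. step_integral S a b e x - step_integral S' a' b' e' x)"
proof (intro exI conjI)
  let ?T = "S <+> S'" and ?c = "case_sum a a'" and ?d = "case_sum b b'"
    and ?f = "case_sum e (\<lambda>i x. - e' i x)"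
  have bnd: "bounded ((\<lambda>x. - f x) ` A)" if "bounded (f ` A)" for f :: "'a \<Rightarrow> real" and A
    using that by (auto simp: bounded_iff)
  show "step_family ?T ?c ?d ?f"
    using assms by (auto simp: step_family_def intro!: bnd)
  have fin: "finite S" "finite S'" using assms by (auto simp: step_family_def)
  show "step_process ?T ?c ?d ?f = (\<lambda>z. step_process S a b e z - step_process S' a' b' e' z)"
    unfolding step_process_def case_prod_beta sum.Plus[OF fin]
    by (simp only: o_def sum.case mult_minus_left sum_negf diff_conv_add_uminus)
  show "step_integral ?T ?c ?d ?f = (\<lambda>x. step_integral S a b e x - step_integral S' a' b' e' x)"
    using fin by (auto simp: step_integral_def sum.Plus sum_negf)
qed

text \<open>The martingale property \<open>E (X | F s) = Y\<close>, tested against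
  \<open>\<xi>\<close>. The difficulty is that \<open>X\<close> and \<open>Y\<close> come with
  unrelated approximating sequences. What links them is that both integrands converge to
  \<open>H\<close> on \<open>{0..s}\<close>, so by the isometry the step integrals up to time
  \<open>s\<close> approach each other.\<close>

lemma has_ito_integral_orthogonal:
  assumes X: "has_ito_integral M F B H t X" and Y: "has_ito_integral M F B H s Y"
    and st: "0 \<le> s" "s \<le> t"
    and \<xi>: "\<xi> \<in> borel_measurable (F s)" "square_integrable M \<xi>"
  shows "expectation (\<lambda>x. \<xi> x * X x) = expectation (\<lambda>x. \<xi> x * Y x)"
proof -
  obtain n p e where el: "\<And>k. elementary_integrand M F t (n k) (p k) (e k)"
    and X1: "(\<lambda>k. \<integral>x. (step_integral {..<n k} (p k) (\<lambda>i. p k (Suc i)) (e k) x - X x)\<^sup>2 \<partial>M) \<longlonglongrightarrow> 0"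
    and X2: "(\<lambda>k. \<integral>z. (step_process {..<n k} (p k) (\<lambda>i. p k (Suc i)) (e k) z
       - (case z of (x, r) \<Rightarrow> indicator {0..t} r * H r x))\<^sup>2 \<partial>Mt) \<longlonglongrightarrow> 0"
    and sX: "square_integrable M X"
    and sHt: "square_integrable Mt (\<lambda>(x, r). indicator {0..t} r * H r x)"
    using has_ito_integral_approx[OF X] by blast
  obtain m q f where elY: "\<And>k. elementary_integrand M F s (m k) (q k) (f k)"
    and Y1: "(\<lambda>k. \<integral>x. (step_integral {..<m k} (q k) (\<lambda>i. q k (Suc i)) (f k) x - Y x)\<^sup>2 \<partial>M) \<longlonglongrightarrow> 0"
    and Y2: "(\<lambda>k. \<integral>z. (step_process {..<m k} (q k) (\<lambda>i. q k (Suc i)) (f k) z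
       - (case z of (x, r) \<Rightarrow> indicator {0..s} r * H r x))\<^sup>2 \<partial>Mt) \<longlonglongrightarrow> 0"
    and sY: "square_integrable M Y"
    and sHs: "square_integrable Mt (\<lambda>(x, r). indicator {0..s} r * H r x)"
    using has_ito_integral_approx[OF Y] by blast
  define J where "J k = step_integral {..<n k} (p k) (\<lambda>i. p k (Suc i)) (e k)" for k
  define P where "P k = step_process {..<n k} (p k) (\<lambda>i. p k (Suc i)) (e k)" for k
  define K where "K k = step_integral {..<m k} (q k) (\<lambda>i. q k (Suc i)) (f k)" for k
  define Q where "Q k = step_process {..<m k} (q k) (\<lambda>i. q k (Suc i)) (f k)" for k
  \<comment> \<open>Truncating the step integrands of \<open>X\<close> at time \<open>s\<close> does not change the expectation against \<open>\<xi>\<close>,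
    and the truncated step integrals converge to \<open>Y\<close>.\<close>
  define e' where "e' k i x = (if p k i < s then e k i x else 0)" for k i x
  define J' where "J' k = step_integral {..<n k} (\<lambda>i. min (p k i) s) (\<lambda>i. min (p k (Suc i)) s) (e' k)" for k
  define P' where "P' k = step_process {..<n k} (\<lambda>i. min (p k i) s) (\<lambda>i. min (p k (Suc i)) s) (e' k)" for k
  note sf = elementary_integrand_step_family[OF el]
  note sfY = elementary_integrand_step_family[OF elY]
  note iso = step_isometry_product[OF sf, folded J_def P_def]
  note isoY = step_isometry_product[OF sfY, folded K_def Q_def]
  have e'0: "e' k i = (if p k i < s then e k i else (\<lambda>_. 0))" for k i
    by (auto simp: e'_def fun_eq_iff)
  have sf': "step_family {..<n k} (\<lambda>i. min (p k i) s) (\<lambda>i. min (p k (Suc i)) s) (e' k)" for k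
    unfolding step_family_def
  proof (intro conjI ballI)
    fix i assume "i \<in> {..<n k}"
    then have i: "0 \<le> p k i" "p k i \<le> p k (Suc i)" "e k i \<in> borel_measurable (F (p k i))"
      "bounded (e k i ` space M)" using sf[of k] by (auto simp: step_family_def)
    show "0 \<le> min (p k i) s" using i st(1) by simp
    show "min (p k i) s \<le> min (p k (Suc i)) s" using i by (intro min.mono) auto
    \<comment> \<open>For \<open>p k i \<ge> s\<close> the truncated interval \<open>{s<..s}\<close>
      is empty, and \<open>e k i\<close> need not be known at time \<open>s\<close>; this is why
      \<open>e'\<close> is zero there.\<close>
    show "e' k i \<in> borel_measurable (F (min (p k i) s))" using i by (simp add: e'0)
    show "bounded (e' k i ` space M)" using i by (auto simp: e'0 bounded_iff)
  qed simp
  note iso' = step_isometry_product[OF sf', folded J'_def P'_def]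
  have P'_eq: "P' k (x, r) = indicator {..s} r * P k (x, r)" for k x r
    unfolding P'_def P_def step_process_def prod.case sum_distrib_left
    by (intro sum.cong) (auto simp: e'_def indicator_def)
  have diff: "(\<integral>z. (P' k z - Q k z)\<^sup>2 \<partial>Mt) = expectation (\<lambda>x. (J' k x - K k x)\<^sup>2)" for k
    using step_family_difference[OF sf'[of k] sfY[of k]] step_isometry_product(3)
    unfolding P'_def Q_def J'_def K_def by metis
  have PQ: "(\<lambda>k. \<integral>z. (P' k z - Q k z)\<^sup>2 \<partial>Mt) \<longlonglongrightarrow> 0"
  proof (rule Lim_null_comparison)
    let ?h = "\<lambda>T z. case z of (x, r) \<Rightarrow> indicator {0..T} r * H r x"
    have sP: "square_integrable Mt (\<lambda>z. P k z - ?h t z)" for k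
      using iso(2) sHt by (rule square_integrable_diff)
    have sQ: "square_integrable Mt (\<lambda>z. Q k z - ?h s z)" for k
      using isoY(2) sHs by (rule square_integrable_diff)
    have le: "(P' k z - Q k z)\<^sup>2 \<le> 2 * (P k z - ?h t z)\<^sup>2 + 2 * (Q k z - ?h s z)\<^sup>2" for k z
    proof -
      obtain x r where z: "z = (x, r)" by (cases z)
      \<comment> \<open>Restricting \<open>?h t\<close> to \<open>{..s}\<close> gives
        \<open>?h s\<close>, so the truncated difference is one approximation error minus
        another.\<close>
      have ind: "P' k z - Q k z = indicator {..s} r * (P k z - ?h t z) - (Q k z - ?h s z)"
        using st by (auto simp: z P'_eq indicator_def)
      have sq: "(u - v)\<^sup>2 \<le> 2 * u\<^sup>2 + 2 * v\<^sup>2" for u v :: real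
        using zero_le_power2[of "u + v"] by (simp add: power2_eq_square algebra_simps)
      have "(indicator {..s} r * (P k z - ?h t z))\<^sup>2 \<le> (P k z - ?h t z)\<^sup>2"
        by (simp add: indicator_def)
      then show ?thesis unfolding ind
        using sq[of "indicator {..s} r * (P k z - ?h t z)" "Q k z - ?h s z"] by linarith
    qed
    have "(\<integral>z. (P' k z - Q k z)\<^sup>2 \<partial>Mt) \<le> 2 * (\<integral>z. (P k z - ?h t z)\<^sup>2 \<partial>Mt) + 2 * (\<integral>z. (Q k z - ?h s z)\<^sup>2 \<partial>Mt)" for k
    proof -
      have "(\<integral>z. (P' k z - Q k z)\<^sup>2 \<partial>Mt) \<le> (\<integral>z. 2 * (P k z - ?h t z)\<^sup>2 + 2 * (Q k z - ?h s z)\<^sup>2 \<partial>Mt)"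
        using square_integrable_power2[OF sP] square_integrable_power2[OF sQ]
          square_integrable_power2[OF square_integrable_diff[OF iso'(2) isoY(2)]] le
        by (intro integral_mono) auto
      then show ?thesis
        using square_integrable_power2[OF sP] square_integrable_power2[OF sQ] by simp
    qed
    then show "\<forall>\<^sub>F k in sequentially. norm (\<integral>z. (P' k z - Q k z)\<^sup>2 \<partial>Mt)
      \<le> 2 * (\<integral>z. (P k z - ?h t z)\<^sup>2 \<partial>Mt) + 2 * (\<integral>z. (Q k z - ?h s z)\<^sup>2 \<partial>Mt)"
      by simp
    show "(\<lambda>k. 2 * (\<integral>z. (P k z - ?h t z)\<^sup>2 \<partial>Mt) + 2 * (\<integral>z. (Q k z - ?h s z)\<^sup>2 \<partial>Mt)) \<longlonglongrightarrow> 0"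
      using tendsto_add[OF tendsto_mult_left[OF X2, of 2] tendsto_mult_left[OF Y2, of 2]]
      unfolding P_def Q_def by simp
  qed
  have s0: "square_integrable M (\<lambda>_. 0)" by (simp add: square_integrable_def)
  have c\<xi>: "(\<lambda>k. expectation (\<lambda>x. (\<xi> x - \<xi> x)\<^sup>2)) \<longlonglongrightarrow> 0" by simp
  have 1: "(\<lambda>k. expectation (\<lambda>x. \<xi> x * (J' k x - K k x))) \<longlonglongrightarrow> expectation (\<lambda>x. \<xi> x * 0)"
    by (rule square_integrable_tendsto_mult[OF \<xi>(2) \<xi>(2) s0 _ c\<xi>])
      (use PQ diff square_integrable_diff[OF iso'(1) isoY(1)] in auto)
  have 2: "(\<lambda>k. expectation (\<lambda>x. \<xi> x * K k x)) \<longlonglongrightarrow> expectation (\<lambda>x. \<xi> x * Y x)"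
    using square_integrable_tendsto_mult[OF \<xi>(2) \<xi>(2) sY isoY(1) c\<xi>] Y1 unfolding K_def by simp
  have 3: "(\<lambda>k. expectation (\<lambda>x. \<xi> x * J k x)) \<longlonglongrightarrow> expectation (\<lambda>x. \<xi> x * X x)"
    using square_integrable_tendsto_mult[OF \<xi>(2) \<xi>(2) sX iso(1) c\<xi>] X1 unfolding J_def by simp
  have 4: "expectation (\<lambda>x. \<xi> x * J k x) = expectation (\<lambda>x. \<xi> x * J' k x)" for k
  proof -
    \<comment> \<open>The part of each increment after time \<open>s\<close>. The factor
      \<open>\<xi> x * e k i x\<close> is known at the start of that part and integrable because
      \<open>e k i\<close> is bounded, so the expectation is zero.\<close>
    let ?D = "\<lambda>i x. (\<xi> x * e k i x) * (B (max (p k (Suc i)) s) x - B (max (p k i) s) x)"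
    have D: "integrable M (?D i) \<and> expectation (?D i) = 0" if i: "i < n k" for i
    proof -
      have "e k i \<in> borel_measurable (F (p k i))" "bounded (e k i ` space M)" "p k i \<le> p k (Suc i)"
        using sf[of k] i by (auto simp: step_family_def)
      note ei = F_measurable_mono[OF max.cobounded1 this(1), of s] this(2) F_measurable[OF this(1)] this(3)
      have "(\<lambda>x. \<xi> x * e k i x) \<in> borel_measurable (F (max (p k i) s))"
        using ei(1) F_measurable_mono[OF max.cobounded2 \<xi>(1), of "p k i"] by measurable
      moreover have "integrable M (\<lambda>x. \<xi> x * e k i x)"
        using integrable_bounded_mult[OF ei(3,2) square_integrable_imp_integrable[OF \<xi>(2)]]
        by (simp add: mult.commute)
      ultimately show ?thesis
        using mult_increment(1,2)[of "max (p k i) s" "max (p k (Suc i)) s"] st(1) ei(4) by auto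
    qed
    have "\<xi> x * J k x - \<xi> x * J' k x = (\<Sum>i<n k. ?D i x)" for x
    proof -
      have "e k i x * (B (p k (Suc i)) x - B (p k i) x)
        - e' k i x * (B (min (p k (Suc i)) s) x - B (min (p k i) s) x)
        = e k i x * (B (max (p k (Suc i)) s) x - B (max (p k i) s) x)" if "i < n k" for i
      proof -
        have "p k i \<le> p k (Suc i)" using sf[of k] that by (auto simp: step_family_def)
        then show ?thesis
          by (cases "p k i = p k (Suc i)") (auto simp: e'_def max_def min_def algebra_simps)
      qed
      then show ?thesis
        unfolding J_def J'_def step_integral_def right_diff_distrib[symmetric] sum_subtractf[symmetric]
        by (simp add: sum_distrib_left mult.assoc)
    qed
    then have "expectation (\<lambda>x. \<xi> x * J k x - \<xi> x * J' k x) = (\<Sum>i<n k. expectation (?D i))"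
      using D by (simp add: Bochner_Integration.integral_sum)
    then show ?thesis
      using D square_integrable_mult[OF \<xi>(2) iso(1)] square_integrable_mult[OF \<xi>(2) iso'(1)] by simp
  qed
  have "(\<lambda>k. expectation (\<lambda>x. \<xi> x * J k x)) \<longlonglongrightarrow> expectation (\<lambda>x. \<xi> x * 0) + expectation (\<lambda>x. \<xi> x * Y x)"
  proof -
    have "expectation (\<lambda>x. \<xi> x * (J' k x - K k x)) + expectation (\<lambda>x. \<xi> x * K k x) = expectation (\<lambda>x. \<xi> x * J k x)" for k
      using square_integrable_mult[OF \<xi>(2) iso'(1)] square_integrable_mult[OF \<xi>(2) isoY(1)]
      by (simp add: 4 right_diff_distrib)
    then show ?thesis using tendsto_add[OF 1 2] by simp
  qed
  from LIMSEQ_unique[OF this 3] show ?thesis by simp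
qed

text \<open>The time set is a null set, so the empty step integrand approximates every
  \<open>H\<close>. Since the equation speaks only of \<open>t > 0\<close>, this supplies the Ito
  integral at time zero, and with it the vanishing mean of the later ones.\<close>

lemma has_ito_integral_zero_interval:
  assumes "square_integrable_process M F {0..0} H"
  shows "has_ito_integral M F B H 0 (\<lambda>_. 0)"
  unfolding has_ito_integral_def
proof (intro conjI exI[of _ "\<lambda>_. 0"] exI[of _ "\<lambda>_ _. 0"] exI[of _ "\<lambda>_ _ _. 0"] allI)
  have "(\<integral>\<^sup>+t\<in>{0..0::real}. f t \<partial>lborel) = 0" for f
  proof -
    have "(\<integral>\<^sup>+t\<in>{0..0::real}. f t \<partial>lborel) = (\<integral>\<^sup>+t. 0 \<partial>(lborel :: real measure))"
      by (rule nn_integral_cong_AE)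
        (use AE_lborel_singleton[of "0::real"] in \<open>eventually_elim, auto simp: indicator_def\<close>)
    then show ?thesis by simp
  qed
  then show "(\<lambda>k. \<integral>\<^sup>+x. (\<integral>\<^sup>+t\<in>{0..0}. ennreal ((H t x - elementary_process 0 (\<lambda>_. 0) (\<lambda>_ _. 0) t x)\<^sup>2)
      \<partial>lborel) \<partial>M) \<longlonglongrightarrow> 0" by simp
  show "(\<lambda>k. \<integral>\<^sup>+x. ennreal ((0 - elementary_integral B 0 (\<lambda>_. 0) (\<lambda>_ _. 0) x)\<^sup>2) \<partial>M) \<longlonglongrightarrow> 0"
    by (simp add: elementary_integral_def)
qed (use assms in \<open>auto simp: elementary_integrand_def\<close>)

end

section \<open>Integrals over moving intervals\<close>

text \<open>A full-line integral with a cut-off, so that Fubini applies and the endpoints may vary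
  measurably. For \<open>b < a\<close> the value is zero, not the negative of the reversed
  integral.\<close>

definition segint :: "real \<Rightarrow> real \<Rightarrow> (real \<Rightarrow> real) \<Rightarrow> real" where
  "segint a b f = (\<integral>s. indicator {a..b} s * f s \<partial>lborel)"

lemma integrable_indicator_times:
  fixes f :: "'a \<Rightarrow> real"
  assumes "A \<in> sets M" "integrable M f"
  shows "integrable M (\<lambda>x. indicator A x * f x)"
  using integrable_mult_indicator[OF assms] by simp

lemma segint_add:
  assumes "integrable lborel f" "a \<le> b" "b \<le> c"
  shows "segint a c f = segint a b f + segint b c f"
proof -
  have "segint a c f = (\<integral>s. indicator {a..b} s * f s + indicator {b..c} s * f s \<partial>lborel)"
    unfolding segint_def
  proof (rule integral_cong_AE)
    show "(\<lambda>s. indicator {a..c} s * f s) \<in> borel_measurable lborel"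
      using borel_measurable_integrable[OF assms(1)] by measurable
    show "(\<lambda>s. indicator {a..b} s * f s + indicator {b..c} s * f s) \<in> borel_measurable lborel"
      using borel_measurable_integrable[OF assms(1)] by measurable
    show "AE s in lborel. indicator {a..c} s * f s = indicator {a..b} s * f s + indicator {b..c} s * f s"
      using AE_lborel_singleton[of b] by eventually_elim (use assms in \<open>auto simp: indicator_def\<close>)
  qed
  then show ?thesis
    using assms(1) by (simp add: segint_def integrable_indicator_times)
qed

lemma segint_cong: "(\<And>s. s \<in> {a..b} \<Longrightarrow> f s = g s) \<Longrightarrow> segint a b f = segint a b g"
  unfolding segint_def by (rule Bochner_Integration.integral_cong) (auto simp: indicator_def)

lemma segint_plus:
  "integrable lborel f \<Longrightarrow> integrable lborel g \<Longrightarrow>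
    segint a b (\<lambda>s. f s + g s) = segint a b f + segint a b g"
  by (simp add: segint_def distrib_left integrable_indicator_times)

lemma segint_minus:
  "integrable lborel f \<Longrightarrow> integrable lborel g \<Longrightarrow>
    segint a b (\<lambda>s. f s - g s) = segint a b f - segint a b g"
  by (simp add: segint_def right_diff_distrib integrable_indicator_times)

lemma segint_cmult: "segint a b (\<lambda>s. c * f s) = c * segint a b f"
  by (simp add: segint_def mult.left_commute)

lemma segint_trivial: "segint a a f = 0"
proof -
  have "AE s in lborel. indicator {a..a} s * f s = 0"
    using AE_lborel_singleton[of a] by eventually_elim (auto simp: indicator_def)
  then show ?thesis unfolding segint_def by (rule integral_eq_zero_AE)
qed

lemma segint_shift: "segint (a + c) (b + c) (\<lambda>s. f (s - c)) = segint a b f"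
  unfolding segint_def
  by (subst lborel_integral_real_affine[of 1 _ c]) (auto intro!: Bochner_Integration.integral_cong simp: indicator_def)

lemma segint_nonneg: "(\<And>s. 0 \<le> f s) \<Longrightarrow> 0 \<le> segint a b f"
  unfolding segint_def by (rule Bochner_Integration.integral_nonneg) simp

lemma segint_mono_interval:
  assumes "integrable lborel f" "\<And>s. 0 \<le> f s" "a' \<le> a" "b \<le> b'"
  shows "segint a b f \<le> segint a' b' f"
  unfolding segint_def using assms
  by (intro integral_mono integrable_indicator_times) (auto simp: indicator_def)

lemma abs_segint_le:
  assumes "integrable lborel f"
  shows "\<bar>segint a b f\<bar> \<le> (\<integral>s. \<bar>f s\<bar> \<partial>lborel)"
proof -
  have "\<bar>segint a b f\<bar> \<le> (\<integral>s. \<bar>indicator {a..b} s * f s\<bar> \<partial>lborel)"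
    unfolding segint_def by (rule integral_abs_bound)
  also have "\<dots> \<le> (\<integral>s. \<bar>f s\<bar> \<partial>lborel)"
    using assms by (intro integral_mono integrable_abs integrable_indicator_times) (auto simp: indicator_def)
  finally show ?thesis .
qed

lemma square_integrable_indicator_Icc:
  "square_integrable lborel (indicator {a..b} :: real \<Rightarrow> real)"
proof -
  have "(\<lambda>s. (indicator {a..b} s :: real)\<^sup>2) = (indicator {a..b} :: real \<Rightarrow> real)"
    by (auto simp: indicator_def fun_eq_iff)
  then show ?thesis
    by (auto simp: square_integrable_def intro!: integrable_real_indicator emeasure_bounded_finite)
qed

lemma segint_square_le:
  assumes "square_integrable lborel f" "a \<le> b"
  shows "(segint a b f)\<^sup>2 \<le> (b - a) * segint a b (\<lambda>s. (f s)\<^sup>2)"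
proof -
  have f: "square_integrable lborel (\<lambda>s. indicator {a..b} s * f s)"
    using assms(1) by (rule square_integrable_bound)
      (use square_integrable_measurable[OF assms(1)] in \<open>auto simp: indicator_def\<close>)
  have sq: "(indicator {a..b} s :: real)\<^sup>2 = indicator {a..b} s" for s :: real
    by (simp add: indicator_def)
  have "\<bar>segint a b f\<bar> \<le> sqrt (b - a) * sqrt (segint a b (\<lambda>s. (f s)\<^sup>2))"
    using square_integrable_Cauchy_Schwarz[OF square_integrable_indicator_Icc[of a b] f] assms(2)
    by (simp add: segint_def mult.assoc[symmetric] sq power2_eq_square[symmetric] power_mult_distrib)
  also have "\<dots> = sqrt ((b - a) * segint a b (\<lambda>s. (f s)\<^sup>2))"
    by (simp add: real_sqrt_mult)
  finally have "(segint a b f)\<^sup>2 \<le> (sqrt ((b - a) * segint a b (\<lambda>s. (f s)\<^sup>2)))\<^sup>2"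
    by (subst power2_abs[symmetric]) (rule power_mono, auto)
  then show ?thesis
    using assms(2) segint_nonneg[of "\<lambda>s. (f s)\<^sup>2"] by simp
qed

text \<open>By symmetry the triangles below and above the diagonal carry the same integral; the
  diagonal is a null set, and together they form the square. This stands in for differentiating
  \<open>W\<^sup>2 / 2\<close> and needs no continuity of \<open>h\<close>.\<close>

lemma integral_triangle:
  fixes h :: "real \<Rightarrow> real"
  assumes h: "integrable lborel h"
  shows "(\<integral>r. h r * (\<integral>s. indicator {..r} s * h s \<partial>lborel) \<partial>lborel) = (\<integral>r. h r \<partial>lborel)\<^sup>2 / 2"
proof -
  note [measurable] = borel_measurable_integrable[OF h]
  have P: "integrable (lborel \<Otimes>\<^sub>M lborel) (\<lambda>(r, s). h r * h s)"
  proof (rule lborel_pair.Fubini_integrable)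
    show "integrable lborel (\<lambda>x. \<integral>y. norm (case (x, y) of (r, s) \<Rightarrow> h r * h s) \<partial>lborel)"
      using h by (simp add: abs_mult)
  qed (use h in auto)
  have ind: "(\<lambda>(r, s). indicator {..r} s * (h r * h s)) \<in> borel_measurable (lborel \<Otimes>\<^sub>M lborel)"
    unfolding indicator_def atMost_iff by measurable
  have L: "integrable (lborel \<Otimes>\<^sub>M lborel) (\<lambda>(r, s). indicator {..r} s * (h r * h s))"
    by (rule Bochner_Integration.integrable_bound[OF P ind]) (auto simp: indicator_def)
  have U: "integrable (lborel \<Otimes>\<^sub>M lborel) (\<lambda>(r, s). (1 - indicator {..r} s) * (h r * h s))"
    using Bochner_Integration.integrable_diff[OF P L] by (simp add: case_prod_unfold algebra_simps)
  let ?A = "\<integral>r. h r * (\<integral>s. indicator {..r} s * h s \<partial>lborel) \<partial>lborel"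
  have A: "?A = (\<integral>z. (case z of (r, s) \<Rightarrow> indicator {..r} s * (h r * h s)) \<partial>(lborel \<Otimes>\<^sub>M lborel))"
    by (subst lborel_pair.integral_fst[OF L, symmetric]) (simp add: mult.left_commute)
  have "(\<integral>z. (case z of (r, s) \<Rightarrow> (1 - indicator {..r} s) * (h r * h s)) \<partial>(lborel \<Otimes>\<^sub>M lborel))
    = (\<integral>s. (\<integral>r. (1 - indicator {..r} s) * (h r * h s) \<partial>lborel) \<partial>lborel)"
    by (rule lborel_pair.integral_snd[OF U, symmetric])
  also have "\<dots> = (\<integral>s. h s * (\<integral>r. indicator {..s} r * h r \<partial>lborel) \<partial>lborel)"
  proof (rule Bochner_Integration.integral_cong[OF refl])
    fix s
    have "(\<integral>r. (1 - indicator {..r} s) * (h r * h s) \<partial>lborel) = (\<integral>r. h s * (indicator {..s} r * h r) \<partial>lborel)"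
    proof (rule integral_cong_AE)
      show "(\<lambda>r. (1 - indicator {..r} s) * (h r * h s)) \<in> borel_measurable lborel"
        unfolding indicator_def atMost_iff by measurable
      show "AE r in lborel. (1 - indicator {..r} s) * (h r * h s) = h s * (indicator {..s} r * h r)"
        using AE_lborel_singleton[of s] by eventually_elim (auto simp: indicator_def)
    qed measurable
    then show "(\<integral>r. (1 - indicator {..r} s) * (h r * h s) \<partial>lborel) = h s * (\<integral>r. indicator {..s} r * h r \<partial>lborel)"
      by simp
  qed
  finally have B: "?A = (\<integral>z. (case z of (r, s) \<Rightarrow> (1 - indicator {..r} s) * (h r * h s)) \<partial>(lborel \<Otimes>\<^sub>M lborel))"
    by simp
  have "?A + ?A = (\<integral>z. (case z of (r, s) \<Rightarrow> indicator {..r} s * (h r * h s)) +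
     (case z of (r, s) \<Rightarrow> (1 - indicator {..r} s) * (h r * h s)) \<partial>(lborel \<Otimes>\<^sub>M lborel))"
    by (subst Bochner_Integration.integral_add[OF L U]) (simp only: A[symmetric] B[symmetric])
  also have "\<dots> = (\<integral>z. (case z of (r, s) \<Rightarrow> h r * h s) \<partial>(lborel \<Otimes>\<^sub>M lborel))"
    by (intro Bochner_Integration.integral_cong) (auto simp: algebra_simps)
  also have "\<dots> = (\<integral>r. h r \<partial>lborel)\<^sup>2"
    by (subst lborel_pair.integral_fst[OF P, symmetric]) (simp add: power2_eq_square)
  finally show ?thesis by simp
qed

lemma segint_half_square:
  assumes "integrable lborel f"
  shows "segint 0 t (\<lambda>r. f r * segint 0 r f) = (segint 0 t f)\<^sup>2 / 2"
proof -
  have "segint 0 t (\<lambda>r. f r * segint 0 r f)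
    = (\<integral>r. (indicator {0..t} r * f r) * (\<integral>s. indicator {..r} s * (indicator {0..t} s * f s) \<partial>lborel) \<partial>lborel)"
    unfolding segint_def
  proof (rule Bochner_Integration.integral_cong[OF refl])
    fix r
    have "(\<integral>s. indicator {0..r} s * f s \<partial>lborel) = (\<integral>s. indicator {..r} s * (indicator {0..t} s * f s) \<partial>lborel)"
      if "r \<in> {0..t}"
      by (rule Bochner_Integration.integral_cong[OF refl]) (use that in \<open>auto simp: indicator_def\<close>)
    then show "indicator {0..t} r * (f r * (\<integral>s. indicator {0..r} s * f s \<partial>lborel)) =
      (indicator {0..t} r * f r) * (\<integral>s. indicator {..r} s * (indicator {0..t} s * f s) \<partial>lborel)"
      by (simp add: indicator_def)
  qed
  also have "\<dots> = (segint 0 t f)\<^sup>2 / 2"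
    unfolding segint_def
    by (rule integral_triangle) (simp add: integrable_indicator_times assms)
  finally show ?thesis .
qed

lemma measurable_segint_window:
  fixes f :: "'a \<Rightarrow> real \<Rightarrow> real"
  assumes "(\<lambda>(x, t). f x t) \<in> borel_measurable (M \<Otimes>\<^sub>M lborel)"
    and [measurable]: "\<alpha> \<in> borel_measurable borel" "\<beta> \<in> borel_measurable borel"
  shows "(\<lambda>(x, r). segint (\<alpha> r) (\<beta> r) (f x)) \<in> borel_measurable (M \<Otimes>\<^sub>M lborel)"
proof -
  have 1[measurable]: "(\<lambda>p. f (fst (fst p)) (snd p)) \<in> borel_measurable ((M \<Otimes>\<^sub>M lborel) \<Otimes>\<^sub>M lborel)"
    using measurable_compose[OF _ assms(1), of "\<lambda>p. (fst (fst p), snd p)" "(M \<Otimes>\<^sub>M lborel) \<Otimes>\<^sub>M lborel"]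
    by simp
  show ?thesis
    unfolding segint_def case_prod_beta
    by (rule lborel.borel_measurable_lebesgue_integral)
      (unfold indicator_def atLeastAtMost_iff case_prod_beta, measurable)
qed

lemma measurable_segint:
  fixes f :: "'a \<Rightarrow> real \<Rightarrow> real"
  assumes "(\<lambda>(x, t). f x t) \<in> borel_measurable (M \<Otimes>\<^sub>M lborel)"
  shows "(\<lambda>x. segint a b (f x)) \<in> borel_measurable M"
  using measurable_compose[OF _ measurable_segint_window[OF assms, of "\<lambda>_. a" "\<lambda>_. b"], of "\<lambda>x. (x, 0)" M]
  by simp

text \<open>By Fubini: a point \<open>q\<close> lies in the window \<open>[r - \<tau>, r]\<close>
  exactly for \<open>r\<close> in \<open>[q, q + \<tau>]\<close>, a set of length
  \<open>\<tau>\<close>. The calculation runs in nonnegative extended integrals because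
  integrability of the window integral is itself part of the claim.\<close>

lemma segint_sliding_window:
  assumes k: "integrable lborel k" "\<And>s. 0 \<le> k s" and "0 \<le> \<tau>" "s \<le> t"
  shows "segint s t (\<lambda>r. segint (r - \<tau>) r k) \<le> \<tau> * segint (s - \<tau>) t k"
    and "integrable lborel (\<lambda>r. indicator {s..t} r * segint (r - \<tau>) r k)"
proof -
  note [measurable] = borel_measurable_integrable[OF k(1)]
  have seg: "ennreal (segint a b k) = (\<integral>\<^sup>+q. ennreal (indicator {a..b} q * k q) \<partial>lborel)" for a b
    unfolding segint_def
    by (rule nn_integral_eq_integral[symmetric]) (use k in \<open>auto intro: integrable_indicator_times\<close>)
  have w[measurable]: "(\<lambda>r. segint (r - \<tau>) r k) \<in> borel_measurable lborel"
    unfolding segint_def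
    by (rule lborel.borel_measurable_lebesgue_integral)
      (unfold indicator_def atLeastAtMost_iff case_prod_beta, measurable)
  have m1: "(\<lambda>(r, q). ennreal (indicator {s..t} r * indicator {r - \<tau>..r} q * k q)) \<in> borel_measurable (lborel \<Otimes>\<^sub>M lborel)"
    unfolding indicator_def atLeastAtMost_iff by measurable
  have "(\<integral>\<^sup>+r. ennreal (indicator {s..t} r * segint (r - \<tau>) r k) \<partial>lborel)
    = (\<integral>\<^sup>+r. (\<integral>\<^sup>+q. ennreal (indicator {s..t} r * indicator {r - \<tau>..r} q * k q) \<partial>lborel) \<partial>lborel)"
    by (intro nn_integral_cong) (auto simp: seg indicator_def)
  also have "\<dots> = (\<integral>\<^sup>+q. (\<integral>\<^sup>+r. ennreal (indicator {s..t} r * indicator {r - \<tau>..r} q * k q) \<partial>lborel) \<partial>lborel)"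
    by (rule lborel_pair.Fubini'[OF m1, symmetric])
  also have "\<dots> \<le> (\<integral>\<^sup>+q. ennreal (\<tau> * (indicator {s - \<tau>..t} q * k q)) \<partial>lborel)"
  proof (rule nn_integral_mono)
    fix q :: real
    have "(\<integral>\<^sup>+r. ennreal (indicator {s..t} r * indicator {r - \<tau>..r} q * k q) \<partial>lborel)
      \<le> (\<integral>\<^sup>+r. ennreal (indicator {s - \<tau>..t} q * k q) * indicator {q..q + \<tau>} r \<partial>lborel)"
      by (intro nn_integral_mono) (use k in \<open>auto simp: indicator_def\<close>)
    also have "\<dots> = ennreal (\<tau> * (indicator {s - \<tau>..t} q * k q))"
      using assms(3) k(2) by (subst nn_integral_cmult) (auto simp: ennreal_mult'' mult.commute)
    finally show "(\<integral>\<^sup>+r. ennreal (indicator {s..t} r * indicator {r - \<tau>..r} q * k q) \<partial>lborel)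
      \<le> ennreal (\<tau> * (indicator {s - \<tau>..t} q * k q))" .
  qed
  also have "\<dots> = ennreal (\<tau> * segint (s - \<tau>) t k)"
    using assms(3) k(2) by (simp add: ennreal_mult' nn_integral_cmult seg)
  finally have le: "(\<integral>\<^sup>+r. ennreal (indicator {s..t} r * segint (r - \<tau>) r k) \<partial>lborel) \<le> ennreal (\<tau> * segint (s - \<tau>) t k)" .
  have pos: "0 \<le> indicator {s..t} r * segint (r - \<tau>) r k" for r
    using segint_nonneg[of k, OF k(2)] by simp
  show int: "integrable lborel (\<lambda>r. indicator {s..t} r * segint (r - \<tau>) r k)"
  proof (rule integrableI_nonneg)
    show "(\<integral>\<^sup>+r. ennreal (indicator {s..t} r * segint (r - \<tau>) r k) \<partial>lborel) < \<infinity>"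
      using le by (rule le_less_trans) simp
  qed (use pos in auto)
  have "ennreal (segint s t (\<lambda>r. segint (r - \<tau>) r k)) \<le> ennreal (\<tau> * segint (s - \<tau>) t k)"
    using le unfolding segint_def[of s t] by (subst (asm) nn_integral_eq_integral[OF int]) (use pos in auto)
  then show "segint s t (\<lambda>r. segint (r - \<tau>) r k) \<le> \<tau> * segint (s - \<tau>) t k"
    using assms(3) segint_nonneg[of k, OF k(2)] by (subst (asm) ennreal_le_iff) auto
qed

section \<open>Processes with square integrable paths\<close>

lemma square_integrable_indicator_product:
  fixes a b :: real
  assumes f: "square_integrable M f"
  shows "square_integrable (M \<Otimes>\<^sub>M lborel) (\<lambda>(x, t). indicator {a..b} t * f x)"
proof -
  note [measurable] = square_integrable_measurable[OF f]
  have [measurable]: "(\<lambda>(x, t). indicator {a..b} t * f x) \<in> borel_measurable (M \<Otimes>\<^sub>M lborel)"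
    unfolding case_prod_beta
    by (intro borel_measurable_times measurable_compose[OF measurable_snd borel_measurable_indicator]
        measurable_compose[OF measurable_fst square_integrable_measurable[OF f]]) auto
  have "(\<integral>\<^sup>+z. ennreal ((case z of (x, t) \<Rightarrow> indicator {a..b} t * f x)\<^sup>2) \<partial>(M \<Otimes>\<^sub>M lborel))
    = (\<integral>\<^sup>+x. (\<integral>\<^sup>+t. ennreal ((f x)\<^sup>2) * indicator {a..b} t \<partial>lborel) \<partial>M)"
    by (subst lborel.nn_integral_fst[symmetric]) (measurable, auto intro!: nn_integral_cong simp: indicator_def)
  also have "\<dots> = (\<integral>\<^sup>+x. ennreal ((f x)\<^sup>2) \<partial>M) * emeasure lborel {a..b}"
    by (simp add: nn_integral_cmult nn_integral_multc)
  also have "\<dots> < \<infinity>"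
    using f emeasure_bounded_finite[OF bounded_closed_interval[of a b]]
    by (simp add: square_integrable_iff_nn_integral ennreal_mult_less_top)
  finally show ?thesis by (simp add: square_integrable_iff_nn_integral)
qed


lemma AE_product_fst:
  assumes "AE x in M. P x"
  shows "AE z in M \<Otimes>\<^sub>M (lborel :: real measure). P (fst z)"
proof -
  obtain N where N: "{x \<in> space M. \<not> P x} \<subseteq> N" "emeasure M N = 0" "N \<in> sets M"
    using assms by (rule AE_E)
  show ?thesis
  proof (rule AE_I)
    show "{z \<in> space (M \<Otimes>\<^sub>M (lborel :: real measure)). \<not> P (fst z)} \<subseteq> N \<times> UNIV"
      using N(1) by (auto simp: space_pair_measure)
    show "emeasure (M \<Otimes>\<^sub>M (lborel :: real measure)) (N \<times> UNIV) = 0"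
      using N by (subst lborel.emeasure_pair_measure_Times) auto
    show "N \<times> UNIV \<in> sets (M \<Otimes>\<^sub>M (lborel :: real measure))"
      using N(3) sets.top[of lborel] by (intro pair_measureI) auto
  qed
qed


text \<open>Paths vanish outside a compact interval, so that integrability over the full line and
  Fubini can be used without reference to a time set. The delay equation enters by cutting
  \<open>w\<close> off at a horizon \<open>T\<close>.\<close>

locale square_integrable_paths = prob_space M for M :: "'a measure" +
  fixes u :: "'a \<Rightarrow> real \<Rightarrow> real" and A T :: real
  assumes square_integrable_u: "square_integrable (M \<Otimes>\<^sub>M lborel) (\<lambda>(x, t). u x t)"
    and outside: "t \<notin> {A..T} \<Longrightarrow> u x t = 0"
begin

sublocale pair_sigma_finite M lborel ..

abbreviation Mt :: "('a \<times> real) measure" where "Mt \<equiv> M \<Otimes>\<^sub>M lborel"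

lemma u_measurable [measurable]: "(\<lambda>(x, t). u x t) \<in> borel_measurable Mt"
  using square_integrable_u by (rule square_integrable_measurable)

lemma integrable_u_mult:
  assumes "square_integrable Mt (\<lambda>(x, t). indicator {A..T} t * f x t)"
  shows "integrable Mt (\<lambda>(x, t). u x t * f x t)"
proof -
  have "u x t * (indicator {A..T} t * f x t) = u x t * f x t" for x t
    using outside[of t x] by (auto simp: indicator_def)
  then have "(\<lambda>z. (case z of (x, t) \<Rightarrow> u x t) * (case z of (x, t) \<Rightarrow> indicator {A..T} t * f x t))
      = (\<lambda>(x, t). u x t * f x t)"
    by (auto simp only: fun_eq_iff split: prod.splits)
  then show ?thesis
    using square_integrable_mult[OF square_integrable_u assms] by simp
qed

lemma integrable_u: "integrable Mt (\<lambda>(x, t). u x t)"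
  using integrable_u_mult[OF square_integrable_indicator_product[OF square_integrable_const[OF finite_measure_axioms, of 1]]]
  by simp

lemma integrable_u2: "integrable Mt (\<lambda>(x, t). (u x t)\<^sup>2)"
  using square_integrable_power2[OF square_integrable_u] by (simp add: case_prod_unfold)

lemma AE_integrable_path: "AE x in M. integrable lborel (u x)"
  using AE_integrable_fst[OF integrable_u] .

lemma AE_square_integrable_path: "AE x in M. square_integrable lborel (u x)"
  using AE_integrable_fst[OF integrable_u2] AE_integrable_path
  by eventually_elim (auto simp: square_integrable_def)

lemma expectation_segint:
  assumes "integrable Mt (\<lambda>(x, t). f x t)"
  shows "integrable M (\<lambda>x. segint a b (f x))"
    and "expectation (\<lambda>x. segint a b (f x)) = segint a b (\<lambda>t. expectation (\<lambda>x. f x t))"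
proof -
  have ind: "(\<lambda>(x, t). indicator {a..b} t * f x t) = (\<lambda>z. indicator {a..b} (snd z) * (case z of (x, t) \<Rightarrow> f x t))"
    by auto
  have i: "integrable Mt (\<lambda>(x, t). indicator {a..b} t * f x t)"
    by (rule Bochner_Integration.integrable_bound[OF assms])
      (use borel_measurable_integrable[OF assms] in \<open>auto simp: indicator_def ind\<close>)
  show "integrable M (\<lambda>x. segint a b (f x))"
    unfolding segint_def by (rule integrable_fst[OF i])
  show "expectation (\<lambda>x. segint a b (f x)) = segint a b (\<lambda>t. expectation (\<lambda>x. f x t))"
    unfolding segint_def using Fubini_integral[OF i] by simp
qed

section \<open>Mean squares of paths and of their window integrals\<close>

definition energy :: "real \<Rightarrow> real" where
  "energy t = expectation (\<lambda>x. (u x t)\<^sup>2)"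

lemma energy_nonneg: "0 \<le> energy t"
  by (simp add: energy_def)

lemma integrable_energy: "integrable lborel energy"
  unfolding energy_def by (rule integrable_snd[OF integrable_u2])

lemma expectation_segint_u2:
  "integrable M (\<lambda>x. segint a b (\<lambda>t. (u x t)\<^sup>2))"
  "expectation (\<lambda>x. segint a b (\<lambda>t. (u x t)\<^sup>2)) = segint a b energy"
  using expectation_segint[OF integrable_u2] by (simp_all add: energy_def[abs_def])

lemma square_integrable_segint:
  assumes "a \<le> b"
  shows "square_integrable M (\<lambda>x. segint a b (u x))"
    and "expectation (\<lambda>x. (segint a b (u x))\<^sup>2) \<le> (b - a) * segint a b energy"
proof -
  have le: "AE x in M. (segint a b (u x))\<^sup>2 \<le> (b - a) * segint a b (\<lambda>t. (u x t)\<^sup>2)"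
    using AE_square_integrable_path by eventually_elim (rule segint_square_le[OF _ assms])
  have m: "(\<lambda>x. segint a b (u x)) \<in> borel_measurable M"
    by (rule measurable_segint) measurable
  have i: "integrable M (\<lambda>x. (segint a b (u x))\<^sup>2)"
    by (rule Bochner_Integration.integrable_bound[OF integrable_mult_right[OF expectation_segint_u2(1), of "b - a" a b]])
      (use le m in \<open>auto elim!: eventually_mono simp: abs_of_nonneg intro: order_trans[OF _ abs_ge_self]\<close>)
  show "square_integrable M (\<lambda>x. segint a b (u x))" using i m by (simp add: square_integrable_def)
  have "expectation (\<lambda>x. (segint a b (u x))\<^sup>2) \<le> expectation (\<lambda>x. (b - a) * segint a b (\<lambda>t. (u x t)\<^sup>2))"
    by (rule integral_mono_AE[OF i _ le]) (simp add: expectation_segint_u2)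
  then show "expectation (\<lambda>x. (segint a b (u x))\<^sup>2) \<le> (b - a) * segint a b energy"
    by (simp add: expectation_segint_u2)
qed

text \<open>Whatever the window, its integral is in absolute value at most the integral of
  \<open>\<bar>u x s\<bar>\<close> over all times. This bound does not depend on the time and is
  square integrable in \<open>x\<close> by Cauchy-Schwarz, so its product with \<open>u\<close> is
  integrable.\<close>

lemma integrable_u_mult_window:
  assumes "\<alpha> \<in> borel_measurable borel" "\<beta> \<in> borel_measurable borel"
  shows "integrable Mt (\<lambda>(x, t). u x t * segint (\<alpha> t) (\<beta> t) (u x))"
proof (rule integrable_u_mult)
  let ?S = "\<lambda>x. \<integral>s. \<bar>u x s\<bar> \<partial>lborel"
  have S: "?S x = segint A T (\<lambda>s. \<bar>u x s\<bar>)" for x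
    unfolding segint_def by (rule Bochner_Integration.integral_cong) (use outside[of _ x] in \<open>auto simp: indicator_def\<close>)
  interpret abs: square_integrable_paths M "\<lambda>x t. \<bar>u x t\<bar>" A T
  proof
    show "square_integrable Mt (\<lambda>(x, t). \<bar>u x t\<bar>)"
      by (rule square_integrable_bound[OF square_integrable_u]) auto
  qed (simp add: outside)
  have "square_integrable M (\<lambda>x. segint A T (\<lambda>s. \<bar>u x s\<bar>))"
  proof (cases "A \<le> T")
    case True then show ?thesis by (rule abs.square_integrable_segint)
  qed (simp add: segint_def square_integrable_def)
  then have S2: "square_integrable Mt (\<lambda>(x, t). indicator {A..T} t * ?S x)"
    unfolding S by (rule square_integrable_indicator_product)
  show "square_integrable Mt (\<lambda>(x, t). indicator {A..T} t * segint (\<alpha> t) (\<beta> t) (u x))"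
  proof (rule square_integrable_bound[OF S2])
    have [measurable]: "(\<lambda>(x, t). segint (\<alpha> t) (\<beta> t) (u x)) \<in> borel_measurable Mt"
      by (rule measurable_segint_window) (use assms in measurable)
    show "(\<lambda>(x, t). indicator {A..T} t * segint (\<alpha> t) (\<beta> t) (u x)) \<in> borel_measurable Mt"
      by measurable
    show "AE z in Mt. \<bar>case z of (x, t) \<Rightarrow> indicator {A..T} t * segint (\<alpha> t) (\<beta> t) (u x)\<bar>
      \<le> \<bar>case z of (x, t) \<Rightarrow> indicator {A..T} t * ?S x\<bar>"
      using AE_product_fst[OF AE_integrable_path]
    proof eventually_elim
      case (elim z)
      then show ?case
        using abs_segint_le[OF elim, of "\<alpha> (snd z)" "\<beta> (snd z)"]
        by (auto simp: case_prod_unfold abs_mult indicator_def intro: order_trans[OF _ abs_ge_self])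
    qed
  qed
qed

text \<open>The product \<open>w Z\<close>; an Ito formula for \<open>Z\<^sup>2\<close> would have
  \<open>-2 * drift\<close> as its \<open>dt\<close> term.\<close>

definition drift :: "real \<Rightarrow> 'a \<Rightarrow> real \<Rightarrow> real" where
  "drift \<tau> x t = u x t * (u x t - segint (t - \<tau>) t (u x))"

lemma integrable_drift: "integrable Mt (\<lambda>(x, t). drift \<tau> x t)"
proof -
  have "integrable Mt (\<lambda>(x, t). u x t * segint (t - \<tau>) t (u x))"
    by (rule integrable_u_mult_window) measurable
  from Bochner_Integration.integrable_diff[OF integrable_u2 this] show ?thesis
    by (simp add: case_prod_unfold drift_def algebra_simps power2_eq_square)
qed

text \<open>The hypothesis \<open>orth\<close> condenses the martingale property and the equation at
  time \<open>r\<close>: under the expectation, \<open>I\<close> is replaced by an expression in the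
  path alone, and no measurability in time of the Ito integral is required. Integrated over
  \<open>r\<close>, the last summand yields half of \<open>?W\<^sup>2\<close> and the summand with
  \<open>z0\<close> a multiple of \<open>?W\<close>; both cancel in the expanded square.\<close>

lemma second_moment_formula:
  assumes I: "square_integrable M I" "expectation I = 0"
    and orth: "\<And>r. r \<in> {0..t} \<Longrightarrow> expectation (\<lambda>x. u x r * I x)
      = expectation (\<lambda>x. u x r * (u x r - segint (r - \<tau>) r (u x) - z0 + segint 0 r (u x)))"
    and "0 \<le> t"
  shows "expectation (\<lambda>x. (z0 - segint 0 t (u x) + I x)\<^sup>2)
    = z0\<^sup>2 + expectation (\<lambda>x. (I x)\<^sup>2) - 2 * expectation (\<lambda>x. segint 0 t (drift \<tau> x))"
proof -
  let ?W = "\<lambda>x. segint 0 t (u x)"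
  note W = square_integrable_segint(1)[OF assms(4)]
  have uI: "integrable Mt (\<lambda>(x, r). u x r * I x)"
    by (rule integrable_u_mult) (rule square_integrable_indicator_product[OF I(1)])
  have uW: "integrable Mt (\<lambda>(x, r). u x r * segint 0 r (u x))"
    by (rule integrable_u_mult_window) measurable
  let ?f = "\<lambda>x r. drift \<tau> x r - z0 * u x r + u x r * segint 0 r (u x)"
  have f: "integrable Mt (\<lambda>(x, r). ?f x r)"
    using Bochner_Integration.integrable_add[OF Bochner_Integration.integrable_diff[OF
      integrable_drift[of \<tau>] integrable_mult_right[OF integrable_u, of z0]] uW]
    by (simp add: case_prod_unfold)
  have "expectation (\<lambda>x. ?W x * I x) = expectation (\<lambda>x. segint 0 t (\<lambda>r. u x r * I x))"
    by (simp add: segint_def mult.assoc[symmetric])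
  also have "\<dots> = segint 0 t (\<lambda>r. expectation (\<lambda>x. u x r * I x))"
    by (rule expectation_segint(2)[OF uI])
  also have "\<dots> = segint 0 t (\<lambda>r. expectation (\<lambda>x. ?f x r))"
  proof (rule segint_cong)
    fix r assume r: "r \<in> {0..t}"
    show "expectation (\<lambda>x. u x r * I x) = expectation (\<lambda>x. ?f x r)"
      unfolding orth[OF r] by (simp add: drift_def algebra_simps)
  qed
  also have "\<dots> = expectation (\<lambda>x. segint 0 t (?f x))"
    by (rule expectation_segint(2)[OF f, symmetric])
  also have "\<dots> = expectation (\<lambda>x. segint 0 t (drift \<tau> x) - z0 * ?W x + (?W x)\<^sup>2 / 2)"
  proof (rule integral_cong_AE)
    show "AE x in M. segint 0 t (?f x) = segint 0 t (drift \<tau> x) - z0 * ?W x + (?W x)\<^sup>2 / 2"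
      using AE_integrable_path AE_integrable_fst[OF integrable_drift[of \<tau>]] AE_integrable_fst[OF uW]
    proof eventually_elim
      case (elim x)
      have "segint 0 t (?f x) = segint 0 t (drift \<tau> x) - z0 * ?W x + segint 0 t (\<lambda>r. u x r * segint 0 r (u x))"
        using elim by (simp add: segint_plus segint_minus segint_cmult)
      then show ?case using segint_half_square[OF elim(1), of t] by simp
    qed
    show "(\<lambda>x. segint 0 t (?f x)) \<in> borel_measurable M"
      using expectation_segint(1)[OF f] by (rule borel_measurable_integrable)
    show "(\<lambda>x. segint 0 t (drift \<tau> x) - z0 * ?W x + (?W x)\<^sup>2 / 2) \<in> borel_measurable M"
      using borel_measurable_integrable[OF expectation_segint(1)[OF integrable_drift[of \<tau>]]]
        square_integrable_measurable[OF W] by measurable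
  qed
  also have "\<dots> = expectation (\<lambda>x. segint 0 t (drift \<tau> x)) - z0 * expectation ?W + expectation (\<lambda>x. (?W x)\<^sup>2) / 2"
    using expectation_segint(1)[OF integrable_drift] square_integrable_power2[OF W]
      square_integrable_imp_integrable[OF W] by simp
  finally have WI: "expectation (\<lambda>x. ?W x * I x) =
    expectation (\<lambda>x. segint 0 t (drift \<tau> x)) - z0 * expectation ?W + expectation (\<lambda>x. (?W x)\<^sup>2) / 2" .
  have "expectation (\<lambda>x. (z0 - ?W x + I x)\<^sup>2) = expectation (\<lambda>x. z0\<^sup>2 + (?W x)\<^sup>2 + (I x)\<^sup>2 - 2 * z0 * ?W x
    + 2 * z0 * I x - 2 * (?W x * I x))"
    by (intro Bochner_Integration.integral_cong) (auto simp: power2_eq_square algebra_simps)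
  also have "\<dots> = z0\<^sup>2 + expectation (\<lambda>x. (?W x)\<^sup>2) + expectation (\<lambda>x. (I x)\<^sup>2) - 2 * z0 * expectation ?W
    + 2 * z0 * expectation I - 2 * expectation (\<lambda>x. ?W x * I x)"
    using square_integrable_power2[OF W] square_integrable_power2[OF I(1)] square_integrable_mult[OF W I(1)]
      square_integrable_imp_integrable[OF W] square_integrable_imp_integrable[OF I(1)]
    by (simp add: prob_space)
  finally show ?thesis unfolding WI I(2) by simp
qed

lemma drift_estimate:
  assumes "0 \<le> s" "s \<le> t" "0 \<le> \<tau>"
  shows "2 * expectation (\<lambda>x. segint 0 s (drift \<tau> x)) - 2 * expectation (\<lambda>x. segint 0 t (drift \<tau> x))
    \<le> (\<tau> - 2) * segint s t energy + \<tau> * segint (s - \<tau>) t energy"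
proof -
  let ?Q = "\<lambda>x r. (u x r)\<^sup>2"
  note d = expectation_segint(1)[OF integrable_drift[of \<tau>]]
  have "2 * expectation (\<lambda>x. segint 0 s (drift \<tau> x)) - 2 * expectation (\<lambda>x. segint 0 t (drift \<tau> x))
    = expectation (\<lambda>x. 2 * segint 0 s (drift \<tau> x) - 2 * segint 0 t (drift \<tau> x))"
    using d by simp
  also have "\<dots> \<le> expectation (\<lambda>x. (\<tau> - 2) * segint s t (?Q x) + \<tau> * segint (s - \<tau>) t (?Q x))"
  proof (rule integral_mono_AE)
    show "integrable M (\<lambda>x. 2 * segint 0 s (drift \<tau> x) - 2 * segint 0 t (drift \<tau> x))"
      using d by simp
    show "integrable M (\<lambda>x. (\<tau> - 2) * segint s t (?Q x) + \<tau> * segint (s - \<tau>) t (?Q x))"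
      using expectation_segint_u2 by simp
    show "AE x in M. 2 * segint 0 s (drift \<tau> x) - 2 * segint 0 t (drift \<tau> x)
      \<le> (\<tau> - 2) * segint s t (?Q x) + \<tau> * segint (s - \<tau>) t (?Q x)"
      using AE_integrable_path AE_square_integrable_path AE_integrable_fst[OF integrable_drift[of \<tau>]]
    proof eventually_elim
      case (elim x)
      have Q: "integrable lborel (?Q x)" using elim(2) by (rule square_integrable_power2)
      note win = segint_sliding_window[OF Q zero_le_power2 assms(3,2)]
      \<comment> \<open>The window has length \<open>\<tau>\<close>, so the square at the fixed time
        \<open>r\<close> is counted \<open>\<tau>\<close> times, while the square at
        \<open>q\<close> remains as a window integral, which \<open>win\<close> bounds after
        integration in \<open>r\<close>.\<close>
      have pt: "- 2 * drift \<tau> x r \<le> (\<tau> - 2) * ?Q x r + segint (r - \<tau>) r (?Q x)" for r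
      proof -
        have "2 * (u x r * segint (r - \<tau>) r (u x)) = (\<integral>q. indicator {r - \<tau>..r} q * (2 * u x r * u x q) \<partial>lborel)"
          by (simp add: segint_def mult.left_commute)
        also have "\<dots> \<le> (\<integral>q. ?Q x r * indicator {r - \<tau>..r} q + indicator {r - \<tau>..r} q * ?Q x q \<partial>lborel)"
        proof (rule integral_mono)
          show "integrable lborel (\<lambda>q. indicator {r - \<tau>..r} q * (2 * u x r * u x q))"
            using elim(1) by (intro integrable_indicator_times) auto
          show "integrable lborel (\<lambda>q. ?Q x r * indicator {r - \<tau>..r} q + indicator {r - \<tau>..r} q * ?Q x q)"
            using Q by (intro Bochner_Integration.integrable_add integrable_indicator_times integrable_mult_right
              integrable_real_indicator emeasure_bounded_finite) auto
          fix q
          show "indicator {r - \<tau>..r} q * (2 * u x r * u x q) \<le> ?Q x r * indicator {r - \<tau>..r} q + indicator {r - \<tau>..r} q * ?Q x q"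
            using sum_squares_bound[of "u x r" "u x q"] by (simp add: indicator_def)
        qed
        also have "\<dots> = \<tau> * ?Q x r + segint (r - \<tau>) r (?Q x)"
        proof -
          have "integrable lborel (indicator {r - \<tau>..r} :: real \<Rightarrow> real)"
            by (intro integrable_real_indicator emeasure_bounded_finite) auto
          then show ?thesis
            using Q assms(3) by (simp add: segint_def integrable_indicator_times)
        qed
        finally show ?thesis by (simp add: drift_def algebra_simps power2_eq_square)
      qed
      have "segint 0 t (drift \<tau> x) = segint 0 s (drift \<tau> x) + segint s t (drift \<tau> x)"
        by (rule segint_add[OF elim(3) assms(1,2)])
      then have "2 * segint 0 s (drift \<tau> x) - 2 * segint 0 t (drift \<tau> x) = segint s t (\<lambda>r. - 2 * drift \<tau> x r)"
        by (simp add: segint_def mult.left_commute)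
      also have "\<dots> \<le> (\<integral>r. (\<tau> - 2) * (indicator {s..t} r * ?Q x r) + indicator {s..t} r * segint (r - \<tau>) r (?Q x) \<partial>lborel)"
        unfolding segint_def[of s t]
      proof (rule integral_mono)
        show "integrable lborel (\<lambda>r. indicator {s..t} r * (- 2 * drift \<tau> x r))"
          using elim(3) by (intro integrable_indicator_times) auto
        show "integrable lborel (\<lambda>r. (\<tau> - 2) * (indicator {s..t} r * ?Q x r) + indicator {s..t} r * segint (r - \<tau>) r (?Q x))"
          by (intro Bochner_Integration.integrable_add win(2) integrable_mult_right integrable_indicator_times[OF _ Q]) auto
        show "indicator {s..t} r * (- 2 * drift \<tau> x r)
          \<le> (\<tau> - 2) * (indicator {s..t} r * ?Q x r) + indicator {s..t} r * segint (r - \<tau>) r (?Q x)" for r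
          using pt[of r] by (simp add: indicator_def)
      qed
      also have "\<dots> = (\<tau> - 2) * segint s t (?Q x) + segint s t (\<lambda>r. segint (r - \<tau>) r (?Q x))"
        using Q win(2) by (simp add: segint_def[of s t] integrable_indicator_times)
      also have "\<dots> \<le> (\<tau> - 2) * segint s t (?Q x) + \<tau> * segint (s - \<tau>) t (?Q x)"
        using win(1) by simp
      finally show ?case .
    qed
  qed
  also have "\<dots> = (\<tau> - 2) * segint s t energy + \<tau> * segint (s - \<tau>) t energy"
    using expectation_segint_u2 by simp
  finally show ?thesis .
qed

text \<open>Integrability over the product of sample space and time says nothing about one fixed
  time, hence the hypothesis \<open>ut\<close>. Both bounds come from estimating the square of a sum
  by twice the sum of the squares; they let the decay argument pass between
  \<open>E w\<^sup>2\<close> and \<open>E Z\<^sup>2\<close>.\<close>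

lemma second_moment_comparison:
  assumes ut: "square_integrable M (\<lambda>x. u x t)" and "0 \<le> \<tau>"
  defines "n \<equiv> expectation (\<lambda>x. (u x t - segint (t - \<tau>) t (u x))\<^sup>2)"
  shows "n \<le> 2 * energy t + 2 * \<tau> * segint (t - \<tau>) t energy"
    and "energy t \<le> 2 * n + 2 * \<tau> * segint (t - \<tau>) t energy"
proof -
  let ?Y = "\<lambda>x. segint (t - \<tau>) t (u x)"
  have Y: "square_integrable M ?Y" "expectation (\<lambda>x. (?Y x)\<^sup>2) \<le> \<tau> * segint (t - \<tau>) t energy"
    using square_integrable_segint[of "t - \<tau>" t] assms(2) by simp_all
  note Z = square_integrable_diff[OF ut Y(1)]
  note i = square_integrable_power2[OF ut] square_integrable_power2[OF Y(1)] square_integrable_power2[OF Z]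
  have sq: "(a - b)\<^sup>2 \<le> 2 * a\<^sup>2 + 2 * b\<^sup>2" "a\<^sup>2 \<le> 2 * (a - b)\<^sup>2 + 2 * b\<^sup>2" for a b :: real
    using zero_le_power2[of "a + b"] zero_le_power2[of "a - 2 * b"]
    by (simp_all add: power2_eq_square algebra_simps)
  have "n \<le> expectation (\<lambda>x. 2 * (u x t)\<^sup>2 + 2 * (?Y x)\<^sup>2)"
    unfolding n_def using i sq by (intro integral_mono) auto
  then show "n \<le> 2 * energy t + 2 * \<tau> * segint (t - \<tau>) t energy"
    using i Y(2) by (simp add: energy_def)
  have "energy t \<le> expectation (\<lambda>x. 2 * (u x t - ?Y x)\<^sup>2 + 2 * (?Y x)\<^sup>2)"
    unfolding energy_def using i sq by (intro integral_mono) auto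
  then show "energy t \<le> 2 * n + 2 * \<tau> * segint (t - \<tau>) t energy"
    using i Y(2) by (simp add: n_def)
qed

end

section \<open>Decay from integral inequalities\<close>

text \<open>An argument of Datko type: \<open>m s\<close> measures the state at time
  \<open>s\<close> together with its history, \<open>step\<close> bounds the future integral of
  \<open>v\<close> by \<open>m s / \<delta>\<close>, and this bounds the integral of
  \<open>m\<close> by a multiple of \<open>m s\<close>. As \<open>m\<close> grows at most by the
  factor \<open>q\<close>, its value at the end of an interval is at most \<open>q\<close> times its
  average there, which is small on long intervals. Neither continuity nor monotonicity of
  \<open>v\<close> or \<open>n\<close> is involved.\<close>

lemma exponential_decay:
  fixes v n :: "real \<Rightarrow> real"
  assumes \<tau>: "0 \<le> \<tau>" and \<delta>: "0 < \<delta>" and \<kappa>0: "0 \<le> \<kappa>0"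
    and v: "\<And>t. 0 \<le> v t" "\<And>T. 0 \<le> T \<Longrightarrow> integrable lborel (\<lambda>s. indicator {-\<tau>..T} s * v s)"
    and n: "\<And>t. 0 \<le> n t"
    and step: "\<And>s t. 0 \<le> s \<Longrightarrow> s \<le> t \<Longrightarrow>
      n t \<le> n s - \<delta> * segint s t v + \<kappa>0 * segint (s - \<tau>) s v"
    and nv: "\<And>t. 0 \<le> t \<Longrightarrow> n t \<le> 2 * v t + 2 * \<tau> * segint (t - \<tau>) t v"
    and vn: "\<And>t. 0 \<le> t \<Longrightarrow> v t \<le> 2 * n t + 2 * \<tau> * segint (t - \<tau>) t v"
  shows "\<exists>C>0. \<exists>c>0. \<forall>t\<ge>0. v t \<le> C * exp (- c * t)"
proof -
  \<comment> \<open>Adding one makes \<open>\<kappa>\<close> dominate both \<open>\<kappa>0\<close>,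
    so that \<open>m s\<close> bounds the right-hand side of \<open>step\<close>, and 1, so that the
    history integral is at most \<open>m s\<close>.\<close>
  define \<kappa> where "\<kappa> = \<kappa>0 + 1"
  define m where "m s = n s + \<kappa> * segint (s - \<tau>) s v" for s
  \<comment> \<open>The summand 1 accounts for \<open>n t\<close>, the rest for the history part of
    \<open>m t\<close>, whose window lies in \<open>[s - \<tau>, t]\<close>.\<close>
  define q where "q = 1 + \<kappa> * (1 + 1 / \<delta>)"
  \<comment> \<open>\<open>K * m s\<close> bounds the integral over \<open>[s, t]\<close> of the
    upper bound for \<open>m\<close> that \<open>nv\<close> provides: \<open>2 * v r\<close> plus
    \<open>2 * \<tau> + \<kappa>\<close> times the window integral, which costs a factor
    \<open>\<tau>\<close> when integrated in \<open>r\<close>.\<close>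
  define K where "K = 2 / \<delta> + (2 * \<tau> + \<kappa>) * (\<tau> * (1 + 1 / \<delta>))"
  \<comment> \<open>With this length \<open>q * K \<le> h / 2\<close>, so an interval of length
    \<open>h\<close> halves \<open>m\<close>; the added 1 gives \<open>h > 0\<close> from
    \<open>K \<ge> 0\<close> alone.\<close>
  define h where "h = 2 * q * K + 1"
  have \<kappa>: "1 \<le> \<kappa>" "0 < \<kappa>" using \<kappa>0 by (auto simp: \<kappa>_def)
  have q: "1 \<le> q" using \<kappa> \<delta> by (simp add: q_def)
  have K: "0 \<le> K" unfolding K_def using \<tau> \<kappa> \<delta> by (intro add_nonneg_nonneg mult_nonneg_nonneg) auto
  have h: "0 < h" using q K by (auto simp: h_def intro!: add_nonneg_pos)
  have S0: "0 \<le> segint a b v" for a b using segint_nonneg v(1) by blast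
  have m0: "0 \<le> m s" for s using n[of s] S0 \<kappa> by (simp add: m_def)
  \<comment> \<open>\<open>v\<close> is integrable only after a cut-off, so the facts about
    \<open>segint\<close> are applied to the cut-off function and carried back.\<close>
  have cut: "segint a b v = segint a b (\<lambda>s. indicator {-\<tau>..T} s * v s)" if "-\<tau> \<le> a" "b \<le> T" for a b T
    by (rule segint_cong) (use that in auto)
  have add: "segint a c v = segint a b v + segint b c v" if "-\<tau> \<le> a" "a \<le> b" "b \<le> c" "0 \<le> c" for a b c
    using segint_add[OF v(2)[OF that(4)] that(2,3)] that by (simp add: cut[of _ _ c])
  have mono: "segint a b v \<le> segint a' b v" if "-\<tau> \<le> a'" "a' \<le> a" "0 \<le> b" for a a' b
    using segint_mono_interval[OF v(2)[OF that(3)], of a' a b b] that v(1) by (simp add: cut[of _ _ b])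
  have S_le: "segint s t v \<le> m s / \<delta>" and n_le: "n t \<le> m s" if "0 \<le> s" "s \<le> t" for s t
  proof -
    have "\<kappa>0 * segint (s - \<tau>) s v \<le> \<kappa> * segint (s - \<tau>) s v"
      using S0 by (intro mult_right_mono) (auto simp: \<kappa>_def)
    then have *: "n t + \<delta> * segint s t v \<le> m s" using step[OF that] by (simp add: m_def)
    have "0 \<le> \<delta> * segint s t v" using \<delta> S0 by simp
    then show "n t \<le> m s" using * by linarith
    have "\<delta> * segint s t v \<le> m s" using * n[of t] by linarith
    then show "segint s t v \<le> m s / \<delta>" using \<delta> by (simp add: field_simps)
  qed
  have S_self: "segint (s - \<tau>) s v \<le> m s" for s
  proof -
    have "1 * segint (s - \<tau>) s v \<le> \<kappa> * segint (s - \<tau>) s v" by (intro mult_right_mono \<kappa> S0)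
    then show ?thesis using n[of s] unfolding m_def by linarith
  qed
  have S_long: "segint (s - \<tau>) t v \<le> (1 + 1 / \<delta>) * m s" if "0 \<le> s" "s \<le> t" for s t
    using add[of "s - \<tau>" s t] S_self[of s] S_le[OF that] that \<tau> by (simp add: algebra_simps)
  have m_q: "m t \<le> q * m s" if "0 \<le> s" "s \<le> t" for s t
  proof -
    have "segint (t - \<tau>) t v \<le> (1 + 1 / \<delta>) * m s"
      using mono[of "s - \<tau>" "t - \<tau>" t] S_long[OF that] that by linarith
    then have "\<kappa> * segint (t - \<tau>) t v \<le> \<kappa> * ((1 + 1 / \<delta>) * m s)"
      using \<kappa> by (intro mult_left_mono) auto
    then show ?thesis using n_le[OF that] by (simp add: m_def[of t] q_def algebra_simps)
  qed
  have m_int: "(t - s) * m t \<le> q * (K * m s)" if st: "0 \<le> s" "s \<le> t" for s t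
  proof -
    let ?k = "\<lambda>r. indicator {-\<tau>..t} r * v r"
    have t0: "0 \<le> t" using st by simp
    note k = v(2)[OF t0]
    have k0: "0 \<le> ?k r" for r using v(1) by simp
    note win = segint_sliding_window[OF k k0 \<tau> st(2)]
    let ?g = "\<lambda>r. 2 * (indicator {s..t} r * ?k r) + (2 * \<tau> + \<kappa>) * (indicator {s..t} r * segint (r - \<tau>) r ?k)"
    have ig: "integrable lborel (\<lambda>r. indicator {s..t} r * ?k r)"
      by (intro integrable_indicator_times[OF _ k]) auto
    \<comment> \<open>The value \<open>m t\<close> is compared with an average: it is at most
      \<open>q * m r\<close> for every \<open>r\<close> in \<open>[s, t]\<close>.\<close>
    have "(t - s) * m t = (\<integral>r. indicator {s..t} r * m t \<partial>lborel)"
      using st(2) by simp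
    also have "\<dots> \<le> (\<integral>r. q * ?g r \<partial>lborel)"
    proof (rule integral_mono)
      show "integrable lborel (\<lambda>r. indicator {s..t} r * m t)"
        by (intro integrable_mult_left integrable_real_indicator emeasure_bounded_finite) auto
      show "integrable lborel (\<lambda>r. q * ?g r)" using ig win(2) by simp
      show "indicator {s..t} r * m t \<le> q * ?g r" for r
      proof (cases "r \<in> {s..t}")
        case True
        then have r: "0 \<le> r" "r \<le> t" using st by auto
        have kr: "?k r = v r" using True st \<tau> by auto
        have "m r \<le> 2 * v r + (2 * \<tau> + \<kappa>) * segint (r - \<tau>) r v"
          using nv[OF r(1)] by (simp add: m_def algebra_simps)
        also have "segint (r - \<tau>) r v = segint (r - \<tau>) r ?k" using r by (intro cut) auto
        finally have "m r \<le> ?g r" using True by (simp only: kr indicator_simps mult_1)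
        then have "q * m r \<le> q * ?g r" using q by (intro mult_left_mono) auto
        then show ?thesis using m_q[OF r] True by simp
      next
        case False then show ?thesis by simp
      qed
    qed
    also have "\<dots> = q * (2 * segint s t ?k + (2 * \<tau> + \<kappa>) * segint s t (\<lambda>r. segint (r - \<tau>) r ?k))"
      using ig win(2) by (simp add: segint_def[of s t])
    also have "\<dots> \<le> q * (2 * (m s / \<delta>) + (2 * \<tau> + \<kappa>) * (\<tau> * ((1 + 1 / \<delta>) * m s)))"
    proof (intro mult_left_mono add_mono)
      show "segint s t ?k \<le> m s / \<delta>" using S_le[OF st] cut[of s t t] st \<tau> by simp
      have "\<tau> * segint (s - \<tau>) t ?k \<le> \<tau> * ((1 + 1 / \<delta>) * m s)"
        using S_long[OF st] cut[of "s - \<tau>" t t] st \<tau> by (intro mult_left_mono) auto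
      then show "segint s t (\<lambda>r. segint (r - \<tau>) r ?k) \<le> \<tau> * ((1 + 1 / \<delta>) * m s)"
        using win(1) by linarith
    qed (use q \<tau> \<kappa> in auto)
    also have "\<dots> = q * (K * m s)" by (simp add: K_def algebra_simps)
    finally show ?thesis .
  qed
  have half: "m (s + h) \<le> m s / 2" if "0 \<le> s" for s
  proof -
    have "h * m (s + h) \<le> q * (K * m s)" using m_int[OF that, of "s + h"] h by simp
    also have "\<dots> \<le> h * (m s / 2)" using m0[of s] by (simp add: h_def algebra_simps)
    finally show ?thesis using h by (simp add: mult_le_cancel_left_pos)
  qed
  have pow: "m (real k * h) \<le> m 0 / 2 ^ k" for k
  proof (induction k)
    case (Suc k)
    have "m (real (Suc k) * h) \<le> m (real k * h) / 2"
      using half[of "real k * h"] h by (simp add: algebra_simps)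
    then show ?case using Suc by simp
  qed simp
  define c where "c = ln 2 / h"
  \<comment> \<open>The factor 2 before \<open>m 0\<close> pays for rounding \<open>t / h\<close>
    down to an integer, \<open>2 + 2 * \<tau>\<close> comes from \<open>vn\<close>, and the added 1
    keeps \<open>C\<close> positive even if \<open>m 0 = 0\<close>.\<close>
  define C where "C = (2 + 2 * \<tau>) * (q * (2 * m 0)) + 1"
  have c: "0 < c" using h by (simp add: c_def)
  have C: "0 < C" unfolding C_def using \<tau> q m0 by (intro add_nonneg_pos mult_nonneg_nonneg) auto
  have "v t \<le> C * exp (- c * t)" if t: "0 \<le> t" for t
  proof -
    define k where "k = nat \<lfloor>t / h\<rfloor>"
    have k: "real k \<le> t / h" "t / h < real k + 1" using t h by (auto simp: k_def)
    have kh: "real k * h \<le> t" using k(1) h by (simp add: field_simps)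
    have "exp (ln 2 * (real k + 1)) = 2 * 2 ^ k"
    proof -
      have "ln 2 * (real k + 1) = real (Suc k) * ln 2" by (simp add: algebra_simps)
      then show ?thesis by (simp only: exp_of_nat_mult) simp
    qed
    then have "1 / (2 * 2 ^ k) = exp (- (ln 2 * (real k + 1)))"
      by (simp only: exp_minus inverse_eq_divide)
    also have "\<dots> \<le> exp (- (ln 2 * (t / h)))"
      using mult_left_mono[OF less_imp_le[OF k(2)], of "ln 2"] by (simp only: exp_le_cancel_iff neg_le_iff_le) simp
    also have "\<dots> = exp (- c * t)" by (simp add: c_def)
    finally have e: "1 / 2 ^ k \<le> 2 * exp (- c * t)" by (simp add: field_simps)
    have "m t \<le> q * (m 0 / 2 ^ k)"
      using m_q[OF _ kh] pow[of k] h q mult_left_mono[OF pow[of k], of q] by fastforce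
    also have "\<dots> = q * m 0 * (1 / 2 ^ k)" by simp
    also have "\<dots> \<le> q * m 0 * (2 * exp (- c * t))"
      using e q m0 by (intro mult_left_mono) auto
    finally have mt: "m t \<le> q * (2 * m 0) * exp (- c * t)" by (simp add: mult_ac)
    have "v t \<le> 2 * n t + 2 * \<tau> * segint (t - \<tau>) t v" using vn[OF t] .
    also have "\<dots> \<le> 2 * m t + 2 * \<tau> * m t"
      using n_le[of t t] S_self[of t] t \<tau> by (intro add_mono mult_left_mono) auto
    also have "\<dots> = (2 + 2 * \<tau>) * m t" by (simp add: algebra_simps)
    also have "\<dots> \<le> (2 + 2 * \<tau>) * (q * (2 * m 0) * exp (- c * t))"
      using mt \<tau> by (intro mult_left_mono) auto
    also have "\<dots> \<le> C * exp (- c * t)" by (simp add: C_def algebra_simps)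
    finally show ?thesis .
  qed
  then show ?thesis using C c by blast
qed

section \<open>The condition on the parameters\<close>

lemma G_ge_1:
  assumes "0 \<le> s"
  shows "1 \<le> G s"
proof (cases "s = 0")
  case False
  then have "1 \<le> (exp (2 * s) - 1) / (2 * s)"
    using exp_ge_add_one_self[of "2 * s"] assms by (simp add: field_simps)
  then show ?thesis using False by (simp add: G_def)
qed (simp add: G_def)

text \<open>After moving \<open>g * sqrt \<tau>\<close> to the left and squaring,
  \<open>g\<^sup>2 * \<tau>\<close> cancels and \<open>\<sigma>\<^sup>2 + 2 * \<sigma> * (g * sqrt
  \<tau>) + 2 * g * \<tau> < 2\<close> remains; the mixed term is nonnegative and
  \<open>g \<ge> 1\<close>.\<close>

lemma delay_noise_bound:
  assumes "0 \<le> \<tau>" "0 \<le> \<sigma>" "1 \<le> g" "0 \<le> g\<^sup>2 * \<tau> - 2 * g * \<tau> + 2"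
    and "\<sigma> < - g * sqrt \<tau> + sqrt (g\<^sup>2 * \<tau> - 2 * g * \<tau> + 2)"
  shows "\<sigma>\<^sup>2 + 2 * \<tau> < 2"
proof -
  have "0 \<le> \<sigma> + g * sqrt \<tau>" using assms by simp
  moreover have "\<sigma> + g * sqrt \<tau> < sqrt (g\<^sup>2 * \<tau> - 2 * g * \<tau> + 2)" using assms(5) by simp
  ultimately have "(\<sigma> + g * sqrt \<tau>)\<^sup>2 < (sqrt (g\<^sup>2 * \<tau> - 2 * g * \<tau> + 2))\<^sup>2"
    by (intro power_strict_mono) auto
  then have "\<sigma>\<^sup>2 + 2 * \<sigma> * (g * sqrt \<tau>) + 2 * g * \<tau> < 2"
    using assms(1,4) by (simp add: power2_sum power_mult_distrib)
  moreover have "0 \<le> 2 * \<sigma> * (g * sqrt \<tau>)" using assms by simp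
  moreover have "\<tau> \<le> g * \<tau>" using assms mult_right_mono[of 1 g \<tau>] by simp
  ultimately show ?thesis by linarith
qed

section \<open>The delay equation\<close>

locale sdde = brownian_motion M F B
  for M :: "'a measure" and F :: "real \<Rightarrow> 'a measure" and B :: "real \<Rightarrow> 'a \<Rightarrow> real" +
  fixes w :: "real \<Rightarrow> 'a \<Rightarrow> real" and \<tau> \<sigma> w0 :: real
  assumes \<tau>_nonneg: "0 \<le> \<tau>"
    and solution: "sdde_solution M F B \<tau> \<sigma> w0 w"
begin

lemma process: "square_integrable_process M F {-\<tau>..T} w"
  and initial: "AE x in M. \<forall>s\<in>{-\<tau>..0}. w s x = w0"
  using solution by (auto simp: sdde_solution_def)

lemma w_adapted: "- \<tau> \<le> t \<Longrightarrow> w t \<in> borel_measurable (F t)"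
  using process[of t] by (auto simp: square_integrable_process_def)

lemma paths: "square_integrable_paths M (\<lambda>x t. indicator {-\<tau>..T} t * w t x) (-\<tau>) T"
proof
  show "square_integrable Mt (\<lambda>(x, t). indicator {-\<tau>..T} t * w t x)"
    using square_integrable_process_product[OF process] by simp
qed simp

text \<open>Needed for the Ito integral at time zero; inherited from the interval
  \<open>{0..1}\<close>, on which the equation asserts an Ito integral.\<close>

lemma noise_process: "square_integrable_process M F {0..0} (\<lambda>s x. \<sigma> * w (s - \<tau>) x)"
proof -
  obtain I where "has_ito_integral M F B (\<lambda>s x. \<sigma> * w (s - \<tau>) x) 1 I"
    using solution unfolding sdde_solution_def by (metis zero_less_one)
  then have "square_integrable_process M F {0..1} (\<lambda>s x. \<sigma> * w (s - \<tau>) x)"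
    by (simp add: has_ito_integral_def)
  then show ?thesis by (rule square_integrable_process_subset) simp
qed

lemma ito_representation:
  assumes "0 \<le> t"
  shows "\<exists>I. has_ito_integral M F B (\<lambda>s x. \<sigma> * w (s - \<tau>) x) t I \<and>
     (AE x in M. w t x = w0 - segint (-\<tau>) (t - \<tau>) (\<lambda>s. w s x) + I x)"
proof (cases "t = 0")
  case True
  have "AE x in M. w t x = w0 - segint (-\<tau>) (t - \<tau>) (\<lambda>s. w s x) + 0"
    using initial by eventually_elim (use True \<tau>_nonneg in \<open>simp add: segint_trivial\<close>)
  then show ?thesis
    using has_ito_integral_zero_interval[OF noise_process] True by blast
next
  case False
  with assms have "0 < t" by simp
  with solution obtain I where I: "has_ito_integral M F B (\<lambda>s x. \<sigma> * w (s - \<tau>) x) t I"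
    and eq: "AE x in M. w t x = w 0 x + (LBINT s:{0..t}. - w (s - \<tau>) x) + I x"
    unfolding sdde_solution_def by blast
  have sh: "(LBINT s:{0..t}. - w (s - \<tau>) x) = - segint (-\<tau>) (t - \<tau>) (\<lambda>s. w s x)" for x
    using segint_shift[of "-\<tau>" \<tau> "t - \<tau>" "\<lambda>s. w s x"]
    by (simp add: set_lebesgue_integral_def segint_def)
  have "AE x in M. w t x = w0 - segint (-\<tau>) (t - \<tau>) (\<lambda>s. w s x) + I x"
    using eq initial by eventually_elim (use \<tau>_nonneg in \<open>simp add: sh\<close>)
  with I show ?thesis by blast
qed

text \<open>Chosen for each \<open>t\<close> separately, so nothing is known about its dependence on
  \<open>t\<close>; only expectations at fixed times are formed from it.\<close>

definition noise :: "real \<Rightarrow> 'a \<Rightarrow> real" where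
  "noise t = (SOME I. has_ito_integral M F B (\<lambda>s x. \<sigma> * w (s - \<tau>) x) t I \<and>
     (AE x in M. w t x = w0 - segint (-\<tau>) (t - \<tau>) (\<lambda>s. w s x) + I x))"

lemma noise:
  assumes "0 \<le> t"
  shows "has_ito_integral M F B (\<lambda>s x. \<sigma> * w (s - \<tau>) x) t (noise t)"
    and "AE x in M. w t x = w0 - segint (-\<tau>) (t - \<tau>) (\<lambda>s. w s x) + noise t x"
  using someI_ex[OF ito_representation[OF assms]] unfolding noise_def by blast+

lemma square_integrable_noise:
  assumes "0 \<le> t"
  shows "square_integrable M (noise t)"
  by (rule has_ito_integral_approx[OF noise(1)[OF assms]])

lemma segint_path:
  assumes "-\<tau> \<le> a" "b \<le> T"
  shows "segint a b (\<lambda>s. w s x) = segint a b (\<lambda>s. indicator {-\<tau>..T} s * w s x)"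
  by (rule segint_cong) (use assms in auto)

text \<open>The integral of \<open>w\<close> over \<open>[-\<tau>, t]\<close> is split once at
  \<open>0\<close> and once at \<open>t - \<tau>\<close>. Trading one splitting for the other
  removes the delay from the drift; the initial segment contributes \<open>w0 * \<tau>\<close>,
  hence \<open>Z(0) = w0 * (1 - \<tau>)\<close>.\<close>

lemma neutral_form:
  assumes "0 \<le> t"
  shows "AE x in M. w t x - segint (t - \<tau>) t (\<lambda>s. w s x)
    = w0 * (1 - \<tau>) - segint 0 t (\<lambda>s. w s x) + noise t x"
proof -
  interpret P: square_integrable_paths M "\<lambda>x s. indicator {-\<tau>..t} s * w s x" "-\<tau>" t
    by (rule paths)
  show ?thesis
    using noise(2)[OF assms] initial P.AE_integrable_path
  proof eventually_elim
    case (elim x)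
    have "segint (-\<tau>) 0 (\<lambda>s. w s x) = segint (-\<tau>) 0 (\<lambda>s. w0)"
      by (rule segint_cong) (use elim(2) in auto)
    then have init: "segint (-\<tau>) 0 (\<lambda>s. w s x) = w0 * \<tau>"
      using \<tau>_nonneg by (simp add: segint_def)
    have "segint (-\<tau>) t (\<lambda>s. w s x) = segint (-\<tau>) 0 (\<lambda>s. w s x) + segint 0 t (\<lambda>s. w s x)"
      using segint_add[OF elim(3), of "-\<tau>" 0 t] assms \<tau>_nonneg by (simp add: segint_path[of _ _ t])
    moreover have "segint (-\<tau>) t (\<lambda>s. w s x)
        = segint (-\<tau>) (t - \<tau>) (\<lambda>s. w s x) + segint (t - \<tau>) t (\<lambda>s. w s x)"
      using segint_add[OF elim(3), of "-\<tau>" "t - \<tau>" t] assms \<tau>_nonneg by (simp add: segint_path[of _ _ t])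
    ultimately show ?case
      using elim(1) init by (simp add: algebra_simps)
  qed
qed

lemma square_integrable_window:
  assumes "-\<tau> \<le> a" "a \<le> b"
  shows "square_integrable M (\<lambda>x. segint a b (\<lambda>s. w s x))"
proof -
  interpret P: square_integrable_paths M "\<lambda>x s. indicator {-\<tau>..b} s * w s x" "-\<tau>" b
    by (rule paths)
  show ?thesis
    using P.square_integrable_segint(1)[OF assms(2)] assms(1) by (simp add: segint_path[of _ _ b])
qed

text \<open>The integrability built into \<open>sdde_solution\<close> controls only almost every
  time. At a fixed \<open>t \<ge> 0\<close> it is recovered from the equation, whose terms are all
  square integrable; before time zero the value is \<open>w0\<close>.\<close>

lemma square_integrable_w:
  assumes "-\<tau> \<le> t"
  shows "square_integrable M (w t)"
proof -
  have m: "w t \<in> borel_measurable M"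
    using F_measurable[OF w_adapted[OF assms]] .
  show ?thesis
  proof (cases "0 \<le> t")
    case True
    have ae: "AE x in M. w t x = (w0 - segint (-\<tau>) (t - \<tau>) (\<lambda>s. w s x)) + noise t x"
      using noise(2)[OF True] by simp
    have "square_integrable M (\<lambda>x. (w0 - segint (-\<tau>) (t - \<tau>) (\<lambda>s. w s x)) + noise t x)"
      using True
      by (intro square_integrable_add square_integrable_diff square_integrable_const finite_measure_axioms
          square_integrable_window square_integrable_noise) auto
    from square_integrable_cong_AE[OF this m ae] show ?thesis .
  next
    case False
    have "AE x in M. w t x = w0"
      using initial by eventually_elim (use False assms in auto)
    from square_integrable_cong_AE[OF square_integrable_const[OF finite_measure_axioms] m this]
    show ?thesis .
  qed
qed

section \<open>Second moments of the solution and of \<open>Z\<close>\<close>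

definition mean_square :: "real \<Rightarrow> real" where
  "mean_square t = expectation (\<lambda>x. (w t x)\<^sup>2)"

definition neutral_mean_square :: "real \<Rightarrow> real" where
  "neutral_mean_square t = expectation (\<lambda>x. (w t x - segint (t - \<tau>) t (\<lambda>s. w s x))\<^sup>2)"

lemma energy_eq:
  "square_integrable_paths.energy M (\<lambda>x s. indicator {-\<tau>..T} s * w s x) t = indicator {-\<tau>..T} t * mean_square t"
proof -
  interpret P: square_integrable_paths M "\<lambda>x s. indicator {-\<tau>..T} s * w s x" "-\<tau>" T
    by (rule paths)
  show ?thesis
    unfolding P.energy_def mean_square_def by (cases "t \<in> {-\<tau>..T}") auto
qed

lemma segint_energy:
  assumes "-\<tau> \<le> a" "b \<le> T"
  shows "segint a b (square_integrable_paths.energy M (\<lambda>x s. indicator {-\<tau>..T} s * w s x)) = segint a b mean_square"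
  by (rule segint_cong) (use assms in \<open>simp add: energy_eq\<close>)

text \<open>Orthogonality against the constant 1, between the times \<open>t\<close> and 0.\<close>

lemma expectation_noise:
  assumes "0 \<le> t"
  shows "expectation (noise t) = 0"
  using has_ito_integral_orthogonal[OF noise(1)[OF assms] has_ito_integral_zero_interval[OF noise_process]
    order_refl assms, of "\<lambda>_. 1"] square_integrable_const[OF finite_measure_axioms] by simp

text \<open>The isometry, then Fubini to exchange sample and time, then a shift by
  \<open>\<tau>\<close> that carries the delayed argument back to
  \<open>[-\<tau>, t - \<tau>]\<close>.\<close>

lemma expectation_noise_square:
  assumes t: "0 \<le> t"
  shows "expectation (\<lambda>x. (noise t x)\<^sup>2) = \<sigma>\<^sup>2 * segint (-\<tau>) (t - \<tau>) mean_square"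
proof -
  interpret pair_sigma_finite M lborel ..
  have "square_integrable Mt (\<lambda>(x, s). indicator {0..t} s * (\<sigma> * w (s - \<tau>) x))"
    by (rule has_ito_integral_approx[OF noise(1)[OF t]])
  from square_integrable_power2[OF this]
  have int: "integrable Mt (\<lambda>(x, s). (indicator {0..t} s * (\<sigma> * w (s - \<tau>) x))\<^sup>2)"
    by (simp add: case_prod_unfold)
  have "expectation (\<lambda>x. (noise t x)\<^sup>2) = (\<integral>z. (case z of (x, s) \<Rightarrow> (indicator {0..t} s * (\<sigma> * w (s - \<tau>) x))\<^sup>2) \<partial>Mt)"
    using ito_isometry[OF noise(1)[OF t]] by (simp add: case_prod_unfold)
  also have "\<dots> = (\<integral>s. expectation (\<lambda>x. (indicator {0..t} s * (\<sigma> * w (s - \<tau>) x))\<^sup>2) \<partial>lborel)"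
    by (rule integral_snd[OF int, symmetric])
  also have "\<dots> = segint 0 t (\<lambda>s. \<sigma>\<^sup>2 * mean_square (s - \<tau>))"
    unfolding segint_def
    by (rule Bochner_Integration.integral_cong) (auto simp: indicator_def power_mult_distrib mean_square_def)
  also have "\<dots> = \<sigma>\<^sup>2 * segint (-\<tau>) (t - \<tau>) mean_square"
    using segint_shift[of "-\<tau>" \<tau> "t - \<tau>" mean_square] by (simp add: segint_cmult)
  finally show ?thesis .
qed

text \<open>The horizon \<open>T\<close> is kept apart from \<open>t\<close>, so that the formulas
  at two times refer to the same drift and can be subtracted.\<close>

lemma neutral_mean_square_formula:
  assumes t: "0 \<le> t" "t \<le> T"
  shows "neutral_mean_square t = (w0 * (1 - \<tau>))\<^sup>2 + \<sigma>\<^sup>2 * segint (-\<tau>) (t - \<tau>) mean_square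
    - 2 * expectation (\<lambda>x. segint 0 t
        (square_integrable_paths.drift (\<lambda>x s. indicator {-\<tau>..T} s * w s x) \<tau> x))"
proof -
  let ?u = "\<lambda>x s. indicator {-\<tau>..T} s * w s x"
  interpret P: square_integrable_paths M ?u "-\<tau>" T
    by (rule paths)
  have I: "square_integrable M (noise t)" using square_integrable_noise t by simp
  have orth: "expectation (\<lambda>x. ?u x r * noise t x)
      = expectation (\<lambda>x. ?u x r * (?u x r - segint (r - \<tau>) r (?u x) - w0 * (1 - \<tau>) + segint 0 r (?u x)))"
    if r: "r \<in> {0..t}" for r
  proof -
    have r': "0 \<le> r" "r \<le> t" "-\<tau> \<le> r" "r \<le> T" using r t \<tau>_nonneg by auto
    have ur: "?u x r = w r x" for x using r' by simp
    have sr: "square_integrable M (w r)" using square_integrable_w[OF r'(3)] .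
    \<comment> \<open>The martingale property with the \<open>F r\<close>-measurable test variable
      \<open>w r\<close>; afterwards \<open>neutral_form\<close> expresses \<open>noise r\<close>
      through the path.\<close>
    have "expectation (\<lambda>x. w r x * noise t x) = expectation (\<lambda>x. w r x * noise r x)"
      by (rule has_ito_integral_orthogonal[OF noise(1)[OF t(1)] noise(1)[OF r'(1)] r'(1,2) w_adapted[OF r'(3)] sr])
    also have "\<dots> = expectation (\<lambda>x. w r x * (w r x - segint (r - \<tau>) r (?u x) - w0 * (1 - \<tau>) + segint 0 r (?u x)))"
    proof (rule integral_cong_AE)
      show "AE x in M. w r x * noise r x
        = w r x * (w r x - segint (r - \<tau>) r (?u x) - w0 * (1 - \<tau>) + segint 0 r (?u x))"
        using neutral_form[OF r'(1)] by eventually_elim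
          (use r' \<tau>_nonneg in \<open>simp add: segint_path[of _ _ T]\<close>)
      show "(\<lambda>x. w r x * noise r x) \<in> borel_measurable M"
        using square_integrable_measurable[OF sr] square_integrable_measurable[OF square_integrable_noise[OF r'(1)]]
        by measurable
      have "(\<lambda>x. segint (r - \<tau>) r (?u x)) \<in> borel_measurable M" "(\<lambda>x. segint 0 r (?u x)) \<in> borel_measurable M"
        using square_integrable_measurable[OF P.square_integrable_segint(1)] r'(1) \<tau>_nonneg by auto
      then show "(\<lambda>x. w r x * (w r x - segint (r - \<tau>) r (?u x) - w0 * (1 - \<tau>) + segint 0 r (?u x))) \<in> borel_measurable M"
        using square_integrable_measurable[OF sr] by measurable
    qed
    finally show ?thesis unfolding ur .
  qed
  have "neutral_mean_square t = expectation (\<lambda>x. (w0 * (1 - \<tau>) - segint 0 t (?u x) + noise t x)\<^sup>2)"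
    unfolding neutral_mean_square_def
  proof (rule integral_cong_AE)
    show "AE x in M. (w t x - segint (t - \<tau>) t (\<lambda>s. w s x))\<^sup>2 = (w0 * (1 - \<tau>) - segint 0 t (?u x) + noise t x)\<^sup>2"
      using neutral_form[OF t(1)] by eventually_elim (use t \<tau>_nonneg in \<open>simp add: segint_path[of 0 _ T]\<close>)
    show "(\<lambda>x. (w t x - segint (t - \<tau>) t (\<lambda>s. w s x))\<^sup>2) \<in> borel_measurable M"
      using square_integrable_measurable[OF square_integrable_w[of t]]
        square_integrable_measurable[OF square_integrable_window[of "t - \<tau>" t]] t \<tau>_nonneg by simp
    show "(\<lambda>x. (w0 * (1 - \<tau>) - segint 0 t (?u x) + noise t x)\<^sup>2) \<in> borel_measurable M"
      using square_integrable_measurable[OF I] square_integrable_measurable[OF P.square_integrable_segint(1)[OF t(1)]]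
      by simp
  qed
  also have "\<dots> = (w0 * (1 - \<tau>))\<^sup>2 + expectation (\<lambda>x. (noise t x)\<^sup>2) - 2 * expectation (\<lambda>x. segint 0 t (P.drift \<tau> x))"
    by (rule P.second_moment_formula[OF I expectation_noise[OF t(1)] orth t(1)])
  finally show ?thesis
    by (simp add: expectation_noise_square[OF t(1)])
qed

lemma neutral_mean_square_step:
  assumes st: "0 \<le> s" "s \<le> t"
  shows "neutral_mean_square t \<le> neutral_mean_square s
    - (2 - 2 * \<tau> - \<sigma>\<^sup>2) * segint s t mean_square + (\<tau> + \<sigma>\<^sup>2) * segint (s - \<tau>) s mean_square"
proof -
  interpret P: square_integrable_paths M "\<lambda>x s. indicator {-\<tau>..t} s * w s x" "-\<tau>" t
    by (rule paths)
  note seg = segint_energy[where T=t]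
  note add = segint_add[OF P.integrable_energy]
  have 1: "segint (-\<tau>) (t - \<tau>) mean_square = segint (-\<tau>) (s - \<tau>) mean_square + segint (s - \<tau>) (t - \<tau>) mean_square"
    using add[of "-\<tau>" "s - \<tau>" "t - \<tau>"] st \<tau>_nonneg by (simp add: seg)
  have 2: "segint (s - \<tau>) t mean_square = segint (s - \<tau>) s mean_square + segint s t mean_square"
    using add[of "s - \<tau>" s t] st \<tau>_nonneg by (simp add: seg)
  \<comment> \<open>The noise sees the delayed interval \<open>[s - \<tau>, t - \<tau>]\<close>.
    Enlarging it to \<open>[s - \<tau>, t]\<close> and splitting at \<open>s\<close> puts a share
    \<open>\<sigma>\<^sup>2\<close> into the coefficient of \<open>[s, t]\<close> and into that of
    the history.\<close>
  have 3: "segint (s - \<tau>) (t - \<tau>) mean_square \<le> segint (s - \<tau>) t mean_square"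
    using segint_mono_interval[OF P.integrable_energy P.energy_nonneg, of "s - \<tau>" "s - \<tau>" "t - \<tau>" t] st \<tau>_nonneg
    by (simp add: seg)
  have 4: "2 * expectation (\<lambda>x. segint 0 s (P.drift \<tau> x)) - 2 * expectation (\<lambda>x. segint 0 t (P.drift \<tau> x))
    \<le> (\<tau> - 2) * segint s t mean_square + \<tau> * segint (s - \<tau>) t mean_square"
    using P.drift_estimate[OF st \<tau>_nonneg] st \<tau>_nonneg by (simp add: seg)
  have "neutral_mean_square t - neutral_mean_square s
    = \<sigma>\<^sup>2 * segint (s - \<tau>) (t - \<tau>) mean_square
      + (2 * expectation (\<lambda>x. segint 0 s (P.drift \<tau> x)) - 2 * expectation (\<lambda>x. segint 0 t (P.drift \<tau> x)))"
    using neutral_mean_square_formula[of t t] neutral_mean_square_formula[of s t] st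
    by (simp add: 1 algebra_simps)
  also have "\<dots> \<le> \<sigma>\<^sup>2 * segint (s - \<tau>) t mean_square
      + ((\<tau> - 2) * segint s t mean_square + \<tau> * segint (s - \<tau>) t mean_square)"
    by (intro add_mono mult_left_mono 3 4) simp
  finally show ?thesis by (simp add: 2 algebra_simps)
qed

lemma mean_square_exponential_decay:
  assumes "\<sigma>\<^sup>2 + 2 * \<tau> < 2"
  shows "\<exists>C>0. \<exists>c>0. \<forall>t\<ge>0. mean_square t \<le> C * exp (- c * t)"
proof (rule exponential_decay[of \<tau> "2 - 2 * \<tau> - \<sigma>\<^sup>2" "\<tau> + \<sigma>\<^sup>2" mean_square neutral_mean_square])
  show "0 \<le> \<tau>" by (rule \<tau>_nonneg)
  show "0 < 2 - 2 * \<tau> - \<sigma>\<^sup>2" using assms by simp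
  show "0 \<le> \<tau> + \<sigma>\<^sup>2" using \<tau>_nonneg by simp
  show "0 \<le> mean_square t" "0 \<le> neutral_mean_square t" for t
    by (simp_all add: mean_square_def neutral_mean_square_def)
  show "integrable lborel (\<lambda>s. indicator {-\<tau>..T} s * mean_square s)" for T
  proof -
    interpret P: square_integrable_paths M "\<lambda>x s. indicator {-\<tau>..T} s * w s x" "-\<tau>" T
      by (rule paths)
    show ?thesis using P.integrable_energy by (simp add: energy_eq[abs_def])
  qed
  show "neutral_mean_square t \<le> neutral_mean_square s
      - (2 - 2 * \<tau> - \<sigma>\<^sup>2) * segint s t mean_square + (\<tau> + \<sigma>\<^sup>2) * segint (s - \<tau>) s mean_square"
    if "0 \<le> s" "s \<le> t" for s t
    using that by (rule neutral_mean_square_step)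
  fix t :: real assume t: "0 \<le> t"
  interpret P: square_integrable_paths M "\<lambda>x s. indicator {-\<tau>..t} s * w s x" "-\<tau>" t
    by (rule paths)
  have "square_integrable M (\<lambda>x. indicator {-\<tau>..t} t * w t x)"
    using square_integrable_w[of t] t \<tau>_nonneg by simp
  note cmp = P.second_moment_comparison[OF this \<tau>_nonneg]
  have e1: "P.energy t = mean_square t"
    using energy_eq[of t t] t \<tau>_nonneg by simp
  have e2: "segint (t - \<tau>) t P.energy = segint (t - \<tau>) t mean_square"
    by (rule segint_energy) (use t in auto)
  have e3: "expectation (\<lambda>x. (indicator {-\<tau>..t} t * w t x
      - segint (t - \<tau>) t (\<lambda>s. indicator {-\<tau>..t} s * w s x))\<^sup>2) = neutral_mean_square t"
    unfolding neutral_mean_square_def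
    by (rule Bochner_Integration.integral_cong)
      (use t \<tau>_nonneg segint_path[of "t - \<tau>" t t] in auto)
  show "neutral_mean_square t \<le> 2 * mean_square t + 2 * \<tau> * segint (t - \<tau>) t mean_square"
    using cmp(1) unfolding e1 e2 e3 .
  show "mean_square t \<le> 2 * neutral_mean_square t + 2 * \<tau> * segint (t - \<tau>) t mean_square"
    using cmp(2) unfolding e1 e2 e3 .
qed

end

theorem theorem2:
  fixes M :: "'a measure" and F :: "real \<Rightarrow> 'a measure"
    and B w :: "real \<Rightarrow> 'a \<Rightarrow> real" and \<tau> \<sigma> w0 :: real
  assumes "brownian_motion M F B"
    and "\<tau> \<ge> 0" and "\<sigma> \<ge> 0"
    and "\<exists>\<mu>>1.
      2 * \<mu> - 2 * exp (\<mu> * \<tau>) \<ge> 0 \<and>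
      (G (\<mu> * \<tau>))\<^sup>2 * \<tau> - 2 * G (\<mu> * \<tau>) * \<tau> + 2 \<ge> 0 \<and>
      \<sigma> < exp (- \<mu> * \<tau>) * sqrt (2 * \<mu> - 2 * exp (\<mu> * \<tau>)) \<and>
      \<sigma> < - G (\<mu> * \<tau>) * sqrt \<tau> + sqrt ((G (\<mu> * \<tau>))\<^sup>2 * \<tau> - 2 * G (\<mu> * \<tau>) * \<tau> + 2)"
    and "w0 \<noteq> 0"
    and "sdde_solution M F B \<tau> \<sigma> w0 w"
  shows "\<exists>C>0. \<exists>c>0. \<forall>t\<ge>0. integrable M (\<lambda>x. (w t x)\<^sup>2) \<and>
    prob_space.expectation M (\<lambda>x. (w t x)\<^sup>2) \<le> C * exp (- c * t)"
proof -
  interpret brownian_motion M F B by fact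
  interpret sdde M F B w \<tau> \<sigma> w0
    using assms by unfold_locales auto
  from assms(4) obtain \<mu> where \<mu>: "\<mu> > 1" "0 \<le> (G (\<mu> * \<tau>))\<^sup>2 * \<tau> - 2 * G (\<mu> * \<tau>) * \<tau> + 2"
    "\<sigma> < - G (\<mu> * \<tau>) * sqrt \<tau> + sqrt ((G (\<mu> * \<tau>))\<^sup>2 * \<tau> - 2 * G (\<mu> * \<tau>) * \<tau> + 2)"
    by blast
  have "1 \<le> G (\<mu> * \<tau>)" using \<mu>(1) assms(2) by (intro G_ge_1) simp
  from delay_noise_bound[OF assms(2,3) this \<mu>(2,3)] have "\<sigma>\<^sup>2 + 2 * \<tau> < 2" .
  from mean_square_exponential_decay[OF this]
  obtain C c where C: "C > 0" "c > 0" "\<And>t. 0 \<le> t \<Longrightarrow> mean_square t \<le> C * exp (- c * t)" by blast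
  \<comment> \<open>Proved alongside the bound because the expectation of a nonintegrable function
    is zero by convention.\<close>
  have "integrable M (\<lambda>x. (w t x)\<^sup>2)" if "0 \<le> t" for t
    using square_integrable_power2[OF square_integrable_w[of t]] that assms(2) by simp
  with C show ?thesis unfolding mean_square_def by blast
qed

end
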